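(* Consider the sequence $\tilde{x}_{k+1}=\eta_h(\tilde{x}_k)$ for $k\ge 0$, where $\eta_h$ is the discrete flow of a consistent integrator of order $p$, i.e., satisfying $$\eta_h(\tilde{x}_k)=\nu_h(\tilde{x}_k)+h^{p+1}\delta(\tilde{x}_k)+\mathcal{O}(h^{p+2}),$$ where $\nu_h$ denotes the exact flow of $\dot{x}=f(x)$ over time $h$ and $h^{p+1}\delta(\tilde{x}_k)$ is the leading term of the local truncation error. Consider a neural network $\mathcal{N}_\theta: x\mapsto\mathcal{N}_\theta(x)$. An enhanced integrator with discrete flow $x\mapsto\eta_h(x)+h^{p+1}\mathcal{N}_\theta(x)$ satisfies the modified differential equation $$\dot{\tilde{x}}=f(\tilde{x})+h^{p+1}\bigl(\delta(\tilde{x})+\mathcal{N}_\theta(\tilde{x})\bigr)+h^{p+2}f_{p+2}(\tilde{x})+\cdots,$$ where $\tilde{x}(0)=x(0)$ and the function $f_{p+2}$ depends on $f$ and its derivatives.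
   Context: The differential equation $\dot{x}=f(x)$, $x(0)=x_0$, is time-invariant with state in $\mathbb{R}^n$, and the vector field $f$ is assumed to be Lipschitz continuous; its dependence on system parameters is omitted for simplicity. The exact flow $\nu_t$ maps an initial value at time zero to the corresponding solution of $\dot{x}=f(x)$ at time $t$. The discrete flow $\eta_h$ of an explicit one-step numerical scheme with step size $h$ is the map $\tilde{x}_k\mapsto\tilde{x}_{k+1}$ producing the next approximation from the current one, with $\tilde{x}_0=x_0$. The scheme has order $p\in\mathbb{N}$ if its local error, i.e. the error incurred when integrating over a single step of size $h$, is proportional to $h^{p+1}$. A neural network of depth $L\in\mathbb{N}$ is a function $\mathcal{N}_\theta(x)=T_L\,\Xi(T_{L-1}\Xi(\cdots\Xi(T_1(x))))$, where each $T_l$ is an affine-linear map $T_l x=W^{(l)}x+b^{(l)}$, $\Xi$ applies a Lipschitz continuous activation function $\xi:\mathbb{R}\to\mathbb{R}$ componentwise, and $\theta=\{(W^{(l)},b^{(l)})\}_{l=1}^L$ collects the weight matrices and bias vectors. Here its input and output both lie in $\mathbb{R}^n$. The modified differential equation is meant in the sense of backward error analysis.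
   Formalization: The correction δ+N_θ enters at h^p, not h^{p+1}, and f_{p+2} at h^{p+1}; δ is assumed locally Lipschitz and the O-term uniform on compact sets; f_{p+2} and the further series are claimed only if f and N_θ are smooth and the local error has a smooth expansion in h. *)

theory Defs
  imports "HOL-Analysis.Analysis" "Jordan_Normal_Form.Matrix"
begin

(* Jordan_Normal_Form.Matrix reuses the infix dollar sign; it denotes real^'n components here. *)
no_notation Matrix.vec_index (infixl "$" 100)

fun C_k :: "nat \<Rightarrow> ('a::real_normed_vector \<Rightarrow> 'b::real_normed_vector) \<Rightarrow> bool" where
  "C_k 0 g \<longleftrightarrow> continuous_on UNIV g"
| "C_k (Suc k) g \<longleftrightarrow>
     (\<forall>x. g differentiable (at x)) \<and> (\<forall>v. C_k k (\<lambda>x. frechet_derivative g (at x) v))"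

definition smooth :: "('a::real_normed_vector \<Rightarrow> 'b::real_normed_vector) \<Rightarrow> bool" where
  "smooth g \<longleftrightarrow> (\<forall>k. C_k k g)"

text \<open>The order relation \<open>e h x = O(h ^ q)\<close> as \<open>h\<close> tends to \<open>0\<close> from above,
  with constants uniform for \<open>x\<close> in a compact set.\<close>

definition loc_unif_bigo ::
    "(real \<Rightarrow> 'a::topological_space \<Rightarrow> 'b::real_normed_vector) \<Rightarrow> nat \<Rightarrow> bool" where
  "loc_unif_bigo e q \<longleftrightarrow>
     (\<forall>K. compact K \<longrightarrow> (\<exists>C. \<forall>\<^sub>F h in at_right 0. \<forall>x\<in>K. norm (e h x) \<le> C * h ^ q))"

definition is_exact_flow ::
    "('a::real_normed_vector \<Rightarrow> 'a) \<Rightarrow> (real \<Rightarrow> 'a \<Rightarrow> 'a) \<Rightarrow> bool" where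
  "is_exact_flow f \<nu> \<longleftrightarrow>
     (\<forall>x. \<nu> 0 x = x \<and> (\<forall>t. ((\<lambda>s. \<nu> s x) has_vector_derivative f (\<nu> t x)) (at t)))"

definition has_leading_error ::
    "(real \<Rightarrow> 'a::real_normed_vector \<Rightarrow> 'a) \<Rightarrow> (real \<Rightarrow> 'a \<Rightarrow> 'a) \<Rightarrow> nat \<Rightarrow> ('a \<Rightarrow> 'a) \<Rightarrow> bool" where
  "has_leading_error \<eta> \<nu> p \<delta> \<longleftrightarrow>
     loc_unif_bigo (\<lambda>h x. \<eta> h x - (\<nu> h x + h ^ (p + 1) *\<^sub>R \<delta> x)) (p + 2)"

text \<open>The local error has a full asymptotic expansion in powers of \<open>h\<close>, with smooth
  coefficients; \<open>d j\<close> is the coefficient of \<open>h ^ j\<close> and only \<open>j > p\<close> matters.\<close>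

definition has_smooth_error_expansion ::
    "(real \<Rightarrow> 'a::real_normed_vector \<Rightarrow> 'a) \<Rightarrow> (real \<Rightarrow> 'a \<Rightarrow> 'a) \<Rightarrow> nat \<Rightarrow> (nat \<Rightarrow> 'a \<Rightarrow> 'a) \<Rightarrow> bool" where
  "has_smooth_error_expansion \<eta> \<nu> p d \<longleftrightarrow>
     (\<forall>j>p. smooth (d j)) \<and>
     (\<forall>M. loc_unif_bigo (\<lambda>h x. \<eta> h x - (\<nu> h x + (\<Sum>j=p+1..M. h ^ j *\<^sub>R d j x))) (M + 1))"

definition enhanced_flow ::
    "(real \<Rightarrow> 'a::real_normed_vector \<Rightarrow> 'a) \<Rightarrow> nat \<Rightarrow> ('a \<Rightarrow> 'a) \<Rightarrow> real \<Rightarrow> 'a \<Rightarrow> 'a" where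
  "enhanced_flow \<eta> p N h x = \<eta> h x + h ^ (p + 1) *\<^sub>R N x"

definition solves_on :: "(real \<Rightarrow> 'a::real_normed_vector) \<Rightarrow> ('a \<Rightarrow> 'a) \<Rightarrow> real \<Rightarrow> bool" where
  "solves_on y g T \<longleftrightarrow>
     (\<forall>t\<in>{0..T}. (y has_vector_derivative g (y t)) (at t within {0..T}))"

text \<open>Backward error analysis: \<open>F j\<close> is the coefficient of \<open>h ^ j\<close> in the modified vector
  field. The series need not converge, so each truncation is required to reproduce the numerical
  trajectory up to the order in \<open>h\<close> that the truncation can resolve. For \<open>k = 1\<close> the estimate is
  the usual local defect \<open>O(h ^ (M + 2))\<close>; for \<open>h * k \<le> T\<close> it is the global bound
  \<open>O(h ^ (M + 1))\<close>.\<close>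

definition modified_equation_upto ::
    "nat \<Rightarrow> (real \<Rightarrow> 'a::real_normed_vector \<Rightarrow> 'a) \<Rightarrow> (nat \<Rightarrow> 'a \<Rightarrow> 'a) \<Rightarrow> bool" where
  "modified_equation_upto M \<Phi> F \<longleftrightarrow>
     (\<forall>K T. compact K \<and> 0 < T \<longrightarrow>
        (\<exists>C. \<forall>\<^sub>F h in at_right 0. \<forall>x\<^sub>0\<in>K. \<exists>y.
           y 0 = x\<^sub>0 \<and>
           solves_on y (\<lambda>x. \<Sum>j\<le>M. h ^ j *\<^sub>R F j x) T \<and>
           (\<forall>k. h * real k \<le> T \<longrightarrow>
              norm ((\<Phi> h ^^ k) x\<^sub>0 - y (h * real k)) \<le> C * real k * h ^ (M + 2))))"

definition modified_equation ::
    "(real \<Rightarrow> 'a::real_normed_vector \<Rightarrow> 'a) \<Rightarrow> (nat \<Rightarrow> 'a \<Rightarrow> 'a) \<Rightarrow> bool" where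
  "modified_equation \<Phi> F \<longleftrightarrow> (\<forall>M. modified_equation_upto M \<Phi> F)"

text \<open>The layer widths are arbitrary, hence the dimension-free vectors and matrices. The last
  layer is affine, without activation.\<close>

type_synonym nn_params = "(real mat \<times> real Matrix.vec) list"

fun nn_wf :: "nat \<Rightarrow> nn_params \<Rightarrow> nat \<Rightarrow> bool" where
  "nn_wf m [] n \<longleftrightarrow> False"
| "nn_wf m [(W, b)] n \<longleftrightarrow> W \<in> carrier_mat n m \<and> b \<in> carrier_vec n"
| "nn_wf m ((W, b) # l # ls) n \<longleftrightarrow>
     W \<in> carrier_mat (dim_vec b) m \<and> nn_wf (dim_vec b) (l # ls) n"

fun nn_eval :: "(real \<Rightarrow> real) \<Rightarrow> nn_params \<Rightarrow> real Matrix.vec \<Rightarrow> real Matrix.vec" where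
  "nn_eval \<xi> [] v = v"
| "nn_eval \<xi> [(W, b)] v = W *\<^sub>v v + b"
| "nn_eval \<xi> ((W, b) # l # ls) v = nn_eval \<xi> (l # ls) (map_vec \<xi> (W *\<^sub>v v + b))"

text \<open>The coordinates of \<open>real ^ 'n\<close> are numbered by the bijection \<open>to_nat_on UNIV\<close> from the
  finite type \<open>'n\<close> onto \<open>{..<CARD('n)}\<close>.\<close>

definition to_dim_vec :: "real ^ 'n \<Rightarrow> real Matrix.vec" where
  "to_dim_vec x = Matrix.vec CARD('n) (\<lambda>i. x $ from_nat_into UNIV i)"

definition of_dim_vec :: "real Matrix.vec \<Rightarrow> real ^ 'n" where
  "of_dim_vec v = (\<chi> i. vec_index v (to_nat_on UNIV i))"

definition neural_network ::
    "(real \<Rightarrow> real) \<Rightarrow> nn_params \<Rightarrow> real ^ 'n \<Rightarrow> real ^ 'n" where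
  "neural_network \<xi> \<theta> x = of_dim_vec (nn_eval \<xi> \<theta> (to_dim_vec x))"

end

theory Submission
  imports Defs
begin

text \<open>Expanding the flow of a smooth field \<open>\<Sum>j. h ^ j F j\<close> in Lie series, the coefficient of \<open>h ^ (m + 1)\<close>
  in its time-\<open>h\<close> map is \<open>F m\<close> plus terms in \<open>F 0, \<dots>, F (m - 1)\<close>. Matching with the expansion of the
  enhanced integrator (exact flow plus error terms) therefore determines all \<open>F j\<close> recursively; up to
  order \<open>p\<close> the match with the exact flow forces \<open>F 0 = f\<close> and \<open>F j = 0\<close>, the first correction is
  \<open>\<delta> + N\<close>, and the next one contains the second-order Lie terms. Without smoothness, Gronwall's
  inequality gives the local defect for the truncation at \<open>p\<close>. A local defect \<open>O(h ^ (M + 2))\<close> becomes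
  the bound \<open>C k h ^ (M + 2)\<close> after \<open>k\<close> steps by stability of the truncated modified flow.\<close>

subsection \<open>Ordinary differential equations\<close>

text \<open>A field term \<open>h ^ j *\<^sub>R F j\<close> acts for time \<open>h\<close>, so to
  leading order it moves the time-\<open>h\<close> map by \<open>h ^ (j + 1)\<close>. Hence a
  one-step error of order \<open>h ^ (p + 1)\<close> is matched by the coefficient
  \<open>F p\<close>, and truncation at \<open>M\<close> leaves a defect of order
  \<open>h ^ (M + 2)\<close>. The exact flow is treated as the flow of the formal field
  \<open>f, 0, 0, ...\<close>. One expansion lemma thus serves both sides of the matching, and the
  Taylor coefficients of \<open>\<nu>\<close> never have to be computed. The estimates are shaped by
  compactness: the corrections are controlled on compact sets only, and so are the order relations,
  while solutions must exist on all of \<open>[0, T]\<close> and the iterates must remain where the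
  relations hold. Small \<open>h\<close> secures both.\<close>

text \<open>Differentiating \<open>sqrt (norm (u t) ^ 2 + \<epsilon> ^ 2)\<close> instead of the norm avoids its singularity at \<open>0\<close>.\<close>

lemma growth_bound:
  fixes u :: "real \<Rightarrow> 'a::real_inner"
  assumes "0 \<le> a" "0 \<le> L"
    and u: "\<And>t. t \<in> {0..T} \<Longrightarrow> (u has_vector_derivative u' t) (at t within {0..T})"
    and bound: "\<And>t. t \<in> {0..T} \<Longrightarrow> norm (u' t) \<le> a + L * norm (u t)"
    and t: "t \<in> {0..T}"
  shows "norm (u t) \<le> (norm (u 0) + a * t) * exp (L * t)"
proof -
  have eps: "norm (u t) \<le> (norm (u 0) + a * t) * exp (L * t) + \<epsilon> * exp (L * t)" if "0 < \<epsilon>" for \<epsilon>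
  proof -
    define s where "s = (\<lambda>r. sqrt (u r \<bullet> u r + \<epsilon>\<^sup>2))"
    \<comment> \<open>\<open>\<phi>\<close> is built to be nonincreasing: since
      \<open>s' \<le> a + L * s\<close>, the weight \<open>exp (- L * r)\<close> removes the linear
      part and subtracting \<open>a * r\<close> the constant one. Comparing the times
      \<open>0\<close> and \<open>t\<close> gives the estimate.\<close>
    define \<phi> where "\<phi> = (\<lambda>r. s r * exp (- L * r) - a * r)"
    have pos: "0 < u r \<bullet> u r + \<epsilon>\<^sup>2" for r
      using that by (simp add: add_nonneg_pos)
    have s_pos: "0 < s r" and s_ge: "norm (u r) \<le> s r" for r
      using pos[of r] by (auto simp: s_def norm_eq_sqrt_inner)
    define \<phi>' where "\<phi>' = (\<lambda>r. ((u r \<bullet> u' r) / s r - L * s r) * exp (- L * r) - a)"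
    have d\<phi>: "(\<phi> has_real_derivative \<phi>' r) (at r within {0..T})" if r: "r \<in> {0..T}" for r
    proof -
      have "((\<lambda>r. u r \<bullet> u r) has_derivative (\<lambda>h. u r \<bullet> (h *\<^sub>R u' r) + (h *\<^sub>R u' r) \<bullet> u r))
          (at r within {0..T})"
        using u[OF r] unfolding has_vector_derivative_def by (intro has_derivative_inner)
      then have *: "((\<lambda>r. u r \<bullet> u r) has_real_derivative (2 * (u r \<bullet> u' r))) (at r within {0..T})"
        unfolding has_field_derivative_def
        by (rule has_derivative_eq_rhs) (auto simp: inner_commute algebra_simps)
      have "(s has_real_derivative (u r \<bullet> u' r) / s r) (at r within {0..T})"
        unfolding s_def using pos[of r]
        by (auto intro!: derivative_eq_intros * simp: field_simps)
      then show ?thesis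
        unfolding \<phi>_def \<phi>'_def
        by (auto intro!: derivative_eq_intros simp: algebra_simps)
    qed
    have neg: "\<phi>' r \<le> 0" if r: "r \<in> {0..T}" for r
    proof -
      have "u r \<bullet> u' r \<le> norm (u r) * norm (u' r)"
        by (rule norm_cauchy_schwarz)
      also have "\<dots> \<le> norm (u r) * (a + L * norm (u r))"
        by (intro mult_left_mono bound r) auto
      also have "\<dots> \<le> s r * (a + L * s r)"
        using s_ge[of r] s_pos[of r] assms(1,2) by (intro mult_mono add_left_mono mult_left_mono) auto
      finally have "(u r \<bullet> u' r) / s r \<le> a + L * s r"
        using s_pos[of r] by (simp add: field_simps)
      then have "((u r \<bullet> u' r) / s r - L * s r) * exp (- L * r) \<le> a * exp (- L * r)"
        by (intro mult_right_mono) auto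
      \<comment> \<open>Dropping the decay costs sharpness but gives a bound without division by
        \<open>L\<close>. The case \<open>L = 0\<close> serves later as a mean value inequality for
        vector-valued functions.\<close>
      also have "\<dots> \<le> a * 1"
        using assms r by (intro mult_left_mono) auto
      finally show ?thesis by (simp add: \<phi>'_def)
    qed
    have "\<exists>r\<in>{0..t}. \<phi> t - \<phi> 0 = \<phi>' r * (t - 0)"
    proof (rule mvt_very_simple)
      show "(\<phi> has_derivative (*) (\<phi>' r)) (at r within {0..t})" if "0 \<le> r" "r \<le> t" for r
        using d\<phi>[of r] that t unfolding has_field_derivative_def
        by (intro has_derivative_subset[where s = "{0..T}" and t = "{0..t}"]) auto
    qed (use t in auto)
    then obtain r where "r \<in> {0..t}" "\<phi> t - \<phi> 0 = \<phi>' r * t" by auto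
    then have "\<phi> t \<le> \<phi> 0"
      using mult_nonpos_nonneg[of "\<phi>' r" t] neg[of r] t by auto
    then have "s t * exp (- L * t) \<le> s 0 + a * t"
      by (simp add: \<phi>_def)
    also have "s 0 \<le> norm (u 0) + \<epsilon>"
      unfolding s_def using that
      by (intro real_le_lsqrt) (auto simp: power2_eq_square algebra_simps norm_eq_sqrt_inner)
    finally have "s t * exp (- L * t) * exp (L * t) \<le> (norm (u 0) + \<epsilon> + a * t) * exp (L * t)"
      by (intro mult_right_mono) auto
    then have "s t \<le> (norm (u 0) + \<epsilon> + a * t) * exp (L * t)"
      by (simp add: mult.assoc flip: exp_add)
    then show ?thesis
      using s_ge[of t] by (simp add: algebra_simps)
  qed
  show ?thesis
  proof (rule field_le_epsilon)
    fix e :: real assume "0 < e"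
    then show "norm (u t) \<le> (norm (u 0) + a * t) * exp (L * t) + e"
      using eps[of "e / exp (L * t)"] by simp
  qed
qed

text \<open>Writing \<open>y t = exp (l * t) *\<^sub>R v t\<close> turns the integral equation for \<open>y\<close> into a fixed point equation
  for \<open>v\<close> that is a contraction in the supremum norm, whatever the length of the interval.\<close>

lemma picard_lindeloef_global:
  fixes G :: "'a::euclidean_space \<Rightarrow> 'a"
  assumes G: "L-lipschitz_on UNIV G" and T: "0 \<le> T"
  shows "\<exists>y. y 0 = x \<and> solves_on y G T"
proof -
  \<comment> \<open>Any \<open>l > L\<close> makes \<open>L / l\<close> a contraction factor;
    \<open>L + 1\<close> is also positive when \<open>L = 0\<close>.\<close>
  define l where "l = L + 1"
  have L: "0 \<le> L" and l: "0 < l" using lipschitz_on_nonneg[OF G] by (auto simp: l_def)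
  have contG: "continuous_on S G" for S
    using lipschitz_on_continuous_on[OF G] continuous_on_subset by blast
  define g where "g = (\<lambda>(v :: real \<Rightarrow>\<^sub>C 'a) r. G (exp (l * r) *\<^sub>R apply_bcontfun v r))"
  have contg: "continuous_on S (g v)" for S v
    unfolding g_def
    by (rule continuous_on_compose2[OF contG[of UNIV]]) (auto intro!: continuous_intros)
  have intg: "g v integrable_on {0..s}" for v s
    by (intro integrable_continuous_interval contg)
  define H where "H = (\<lambda>v s. exp (- l * s) *\<^sub>R (x + integral {0..s} (g v)))"
  \<comment> \<open>Clamping time to \<open>[0, T]\<close> extends a function on the interval to a
    bounded continuous one on the line, an element of the complete space on which the operator
    acts.\<close>
  define cl where "cl = (\<lambda>t. max 0 (min T t))"
  have cl: "cl t \<in> {0..T}" for t using T by (auto simp: cl_def)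
  have contH: "continuous_on {0..T} (H v)" for v
    unfolding H_def using intg by (intro continuous_intros indefinite_integral_continuous_1)
  have HB: "(\<lambda>t. H v (cl t)) \<in> bcontfun" for v
  proof -
    have "continuous_on UNIV (\<lambda>t. H v (cl t))"
      by (rule continuous_on_compose2[OF contH[of v]]) (use cl in \<open>auto simp: cl_def intro!: continuous_intros\<close>)
    moreover have "bounded (H v ` {0..T})"
      by (intro compact_imp_bounded compact_continuous_image contH) auto
    then have "bounded (range (\<lambda>t. H v (cl t)))"
      by (rule bounded_subset) (use cl in auto)
    ultimately show ?thesis by (simp add: bcontfun_def)
  qed
  define Op where "Op = (\<lambda>v. Bcontfun (\<lambda>t. H v (cl t)))"
  have Op: "apply_bcontfun (Op v) t = H v (cl t)" for v t
    using HB[of v] by (simp add: Op_def Bcontfun_inverse)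
  have contr: "dist (Op u) (Op v) \<le> L / l * dist u v" for u v
  proof (rule dist_bound)
    fix t
    define s where "s = cl t"
    have s: "0 \<le> s" using cl[of t] by (simp add: s_def)
    have exp_int: "((\<lambda>r. L * dist u v * exp (l * r)) has_integral
        L * dist u v / l * exp (l * s) - L * dist u v / l * exp (l * 0)) {0..s}"
      using s l
      by (intro fundamental_theorem_of_calculus)
         (auto simp flip: has_real_derivative_iff_has_vector_derivative intro!: derivative_eq_intros)
    have pt: "norm (g u r - g v r) \<le> L * dist u v * exp (l * r)" for r
    proof -
      have "norm (g u r - g v r) \<le> L * norm (exp (l * r) *\<^sub>R u r - exp (l * r) *\<^sub>R v r)"
        unfolding g_def using lipschitz_onD[OF G] by (simp add: dist_norm)
      also have "\<dots> = L * (exp (l * r) * dist (u r) (v r))"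
        by (simp add: dist_norm flip: scaleR_diff_right)
      also have "\<dots> \<le> L * (exp (l * r) * dist u v)"
        by (intro mult_left_mono dist_bounded L) auto
      finally show ?thesis by (simp add: ac_simps)
    qed
    have "norm (integral {0..s} (g u) - integral {0..s} (g v)) = norm (integral {0..s} (\<lambda>r. g u r - g v r))"
      by (simp add: integral_diff intg)
    also have "\<dots> \<le> integral {0..s} (\<lambda>r. L * dist u v * exp (l * r))"
      using pt exp_int by (intro integral_norm_bound_integral integrable_diff intg) auto
    also have "\<dots> = L * dist u v / l * exp (l * s) - L * dist u v / l"
      using integral_unique[OF exp_int] by simp
    also have "\<dots> \<le> L * dist u v / l * exp (l * s)"
      using L l by simp
    finally have *: "norm (integral {0..s} (g u) - integral {0..s} (g v)) \<le> L * dist u v / l * exp (l * s)" .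
    have "dist (Op u t) (Op v t) = exp (- l * s) * norm (integral {0..s} (g u) - integral {0..s} (g v))"
      by (simp add: Op H_def dist_norm s_def flip: scaleR_diff_right)
    also have "\<dots> \<le> exp (- l * s) * (L * dist u v / l * exp (l * s))"
      using * by (intro mult_left_mono) auto
    also have "\<dots> = L / l * dist u v"
      by (simp add: exp_minus)
    finally show "dist (Op u t) (Op v t) \<le> L / l * dist u v" .
  qed
  obtain v where v: "Op v = v"
    using banach_fix_type[of "L / l" Op] contr L l by (auto simp: l_def)
  define y where "y = (\<lambda>t. x + integral {0..t} (g v))"
  have y: "exp (l * t) *\<^sub>R v t = y t" if "t \<in> {0..T}" for t
  proof -
    have "v t = H v (cl t)" using Op[of v t] v by simp
    also have "cl t = t" using that by (auto simp: cl_def)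
    finally show ?thesis by (simp add: H_def y_def flip: exp_add)
  qed
  have "solves_on y G T"
    unfolding solves_on_def
  proof
    fix t assume t: "t \<in> {0..T}"
    have "(y has_vector_derivative g v t) (at t within {0..T})"
      unfolding y_def
      using integral_has_vector_derivative[OF contg t] by (auto intro!: derivative_eq_intros)
    then show "(y has_vector_derivative G (y t)) (at t within {0..T})"
      using y[OF t] by (simp add: g_def)
  qed
  then show ?thesis by (intro exI[of _ y]) (simp add: y_def)
qed

subsection \<open>Smooth maps\<close>

lemma frechet_derivative_eqI:
  "(g has_derivative g') (at x) \<Longrightarrow> frechet_derivative g (at x) v = g' v"
  by (simp flip: frechet_derivative_at)

lemma C_k_Suc_imp_C_k: "C_k (Suc k) g \<Longrightarrow> C_k k g"
proof (induction k arbitrary: g)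
  case 0
  then show ?case
    by (simp add: continuous_at_imp_continuous_on differentiable_imp_continuous_within)
next
  case (Suc k)
  from Suc.prems have d: "\<forall>x. g differentiable (at x)"
    and c: "C_k (Suc k) (\<lambda>x. frechet_derivative g (at x) v)" for v
    by (auto simp only: C_k.simps(2)[of "Suc k"])
  show ?case using d Suc.IH[OF c] by simp
qed

lemma C_k_const: "C_k k (\<lambda>_. c)"
  by (induction k arbitrary: c) auto

lemma C_k_ident: "C_k k (\<lambda>x. x)"
  by (cases k) (auto simp: C_k_const)

lemma C_k_add: "C_k k g \<Longrightarrow> C_k k h \<Longrightarrow> C_k k (\<lambda>x. g x + h x)"
proof (induction k arbitrary: g h)
  case (Suc k)
  have "frechet_derivative (\<lambda>x. g x + h x) (at x) v
      = frechet_derivative g (at x) v + frechet_derivative h (at x) v" for x v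
    using Suc.prems by (intro frechet_derivative_eqI has_derivative_add) (auto simp flip: frechet_derivative_works)
  with Suc show ?case by simp
qed (simp add: continuous_intros)

lemma C_k_bounded_linear: "bounded_linear T \<Longrightarrow> C_k k g \<Longrightarrow> C_k k (\<lambda>x. T (g x))"
proof (induction k arbitrary: g)
  case 0
  then show ?case by (simp add: bounded_linear.continuous_on)
next
  case (Suc k)
  have D: "((\<lambda>x. T (g x)) has_derivative (\<lambda>v. T (frechet_derivative g (at x) v))) (at x)" for x
    using Suc.prems
    by (intro bounded_linear.has_derivative[OF Suc.prems(1)]) (auto simp flip: frechet_derivative_works)
  with Suc show ?case
    by (auto simp: frechet_derivative_eqI[OF D] intro: differentiableI[OF D])
qed

lemma C_k_scaleR:
  fixes a :: "'a::real_normed_vector \<Rightarrow> real"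
  shows "C_k k a \<Longrightarrow> C_k k g \<Longrightarrow> C_k k (\<lambda>x. a x *\<^sub>R g x)"
proof (induction k arbitrary: a g)
  case (Suc k)
  have D: "((\<lambda>x. a x *\<^sub>R g x) has_derivative
      (\<lambda>v. a x *\<^sub>R frechet_derivative g (at x) v + frechet_derivative a (at x) v *\<^sub>R g x)) (at x)" for x
    using Suc.prems by (intro has_derivative_scaleR) (auto simp flip: frechet_derivative_works)
  have "C_k k a" "C_k k g"
    using Suc.prems by (auto intro: C_k_Suc_imp_C_k)
  with Suc show ?case
    by (auto simp: frechet_derivative_eqI[OF D] intro: differentiableI[OF D] intro!: C_k_add)
qed (simp add: continuous_intros)

lemma smooth_const [simp]: "smooth (\<lambda>_. c)"
  and smooth_ident [simp]: "smooth (\<lambda>x. x)"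
  and smooth_add: "smooth g \<Longrightarrow> smooth h \<Longrightarrow> smooth (\<lambda>x. g x + h x)"
  and smooth_bounded_linear: "bounded_linear T \<Longrightarrow> smooth g \<Longrightarrow> smooth (\<lambda>x. T (g x))"
  and smooth_scaleR: "smooth a \<Longrightarrow> smooth g \<Longrightarrow> smooth (\<lambda>x. a x *\<^sub>R g x)"
  by (auto simp: smooth_def C_k_const C_k_ident C_k_add C_k_bounded_linear C_k_scaleR)

lemma smooth_diff: "smooth g \<Longrightarrow> smooth h \<Longrightarrow> smooth (\<lambda>x. g x - h x)"
  using smooth_add[of g "\<lambda>x. - h x"] smooth_bounded_linear[OF bounded_linear_minus[OF bounded_linear_ident], of h]
  by simp

lemma smooth_sum: "(\<And>i. i \<in> I \<Longrightarrow> smooth (g i)) \<Longrightarrow> smooth (\<lambda>x. \<Sum>i\<in>I. g i x)"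
  by (induction I rule: infinite_finite_induct) (auto intro: smooth_add)

lemma smooth_differentiable: "smooth g \<Longrightarrow> g differentiable (at x)"
  by (auto simp: smooth_def dest: spec[of _ "Suc 0"])

lemma smooth_has_derivative: "smooth g \<Longrightarrow> (g has_derivative frechet_derivative g (at x)) (at x)"
  by (simp add: smooth_differentiable flip: frechet_derivative_works)

lemma smooth_continuous_on: "smooth g \<Longrightarrow> continuous_on S g"
  by (simp add: smooth_differentiable continuous_at_imp_continuous_on differentiable_imp_continuous_within)

lemma smooth_directional_derivative: "smooth g \<Longrightarrow> smooth (\<lambda>x. frechet_derivative g (at x) v)"
  unfolding smooth_def using C_k.simps(2) by blast

section \<open>Lie derivatives and Lipschitz bounds on compact sets\<close>

lemma linear_eq_sum_Basis:
  fixes T :: "'a::euclidean_space \<Rightarrow> 'b::real_normed_vector"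
  assumes "linear T"
  shows "T v = (\<Sum>i\<in>Basis. (v \<bullet> i) *\<^sub>R T i)"
proof -
  have "T v = T (\<Sum>i\<in>Basis. (v \<bullet> i) *\<^sub>R i)" by (simp add: euclidean_representation)
  also have "\<dots> = (\<Sum>i\<in>Basis. (v \<bullet> i) *\<^sub>R T i)"
    by (simp add: linear_sum[OF assms] linear_cmul[OF assms])
  finally show ?thesis .
qed

text \<open>\<open>smooth\<close> speaks of derivatives in fixed directions. Here the direction
  moves with the point, so it is expanded in the finite basis, where its coordinates become smooth
  scalar factors.\<close>

lemma smooth_lie_derivative:
  fixes f :: "'a::euclidean_space \<Rightarrow> 'a"
  assumes "smooth g" "smooth f"
  shows "smooth (\<lambda>x. frechet_derivative g (at x) (f x))"
proof -
  have "frechet_derivative g (at x) (f x) = (\<Sum>i\<in>Basis. (f x \<bullet> i) *\<^sub>R frechet_derivative g (at x) i)" for x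
    by (intro linear_eq_sum_Basis linear_frechet_derivative smooth_differentiable assms)
  then show ?thesis
    using assms
    by (auto intro!: smooth_sum smooth_scaleR smooth_directional_derivative
        smooth_bounded_linear[OF bounded_linear_inner_left])
qed

lemma compact_norm_bound:
  assumes "compact K" "continuous_on K g"
  obtains B where "0 < B" "\<And>x. x \<in> K \<Longrightarrow> norm (g x) \<le> B"
  using compact_imp_bounded[OF compact_continuous_image[OF assms(2,1)]]
  unfolding bounded_pos by auto

lemma smooth_lipschitz_on_compact:
  fixes g :: "'a::euclidean_space \<Rightarrow> 'b::real_normed_vector"
  assumes "smooth g" "compact K"
  shows "\<exists>L. L-lipschitz_on K g"
proof -
  \<comment> \<open>The mean value inequality needs a convex set, and \<open>K\<close> need not be
    one; a ball around it is.\<close>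
  obtain R where R: "K \<subseteq> cball 0 R"
    using compact_imp_bounded[OF assms(2)] by (auto simp: bounded_iff subset_iff)
  have "\<exists>B>0. \<forall>x\<in>cball 0 R. norm (frechet_derivative g (at x) i) \<le> B" for i
    using compact_norm_bound[OF compact_cball smooth_continuous_on[OF smooth_directional_derivative[OF assms(1)]]]
    by metis
  then obtain B where B: "\<And>i. 0 < B i"
    "\<And>i x. x \<in> cball 0 R \<Longrightarrow> norm (frechet_derivative g (at x) i) \<le> B i"
    by metis
  define C where "C = (\<Sum>i\<in>(Basis::'a set). B i)"
  have on: "onorm (frechet_derivative g (at x)) \<le> C" if x: "x \<in> cball 0 R" for x
  proof (rule onorm_bound)
    show "0 \<le> C" unfolding C_def by (intro sum_nonneg less_imp_le B(1))
    fix v :: 'a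
    have "norm (frechet_derivative g (at x) v) = norm (\<Sum>i\<in>Basis. (v \<bullet> i) *\<^sub>R frechet_derivative g (at x) i)"
      by (subst linear_eq_sum_Basis) (auto intro!: linear_frechet_derivative smooth_differentiable assms)
    also have "\<dots> \<le> (\<Sum>i\<in>(Basis::'a set). norm v * B i)"
      by (intro sum_norm_le) (auto intro!: mult_mono Basis_le_norm B(2)[OF x])
    also have "\<dots> = C * norm v"
      unfolding C_def by (simp only: sum_distrib_left mult.commute[of "sum B Basis"])
    finally show "norm (frechet_derivative g (at x) v) \<le> C * norm v" .
  qed
  have "C-lipschitz_on (cball 0 R) g"
  proof (rule lipschitz_onI)
    show "0 \<le> C" unfolding C_def by (intro sum_nonneg less_imp_le B(1))
    show "dist (g x) (g y) \<le> C * dist x y" if "x \<in> cball 0 R" "y \<in> cball 0 R" for x y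
      unfolding dist_norm using that on
      by (intro differentiable_bound[of "cball 0 R" g "\<lambda>x. frechet_derivative g (at x)"])
         (auto intro!: has_derivative_at_withinI smooth_has_derivative assms(1))
  qed
  with R show ?thesis using lipschitz_on_subset by blast
qed

subsection \<open>Lie series\<close>

text \<open>The Lagrange form of the remainder fails for vector values. Instead, the derivative of
  the remainder is the remainder of order one less for the shifted family, and
  \<open>growth_bound\<close> with \<open>L = 0\<close> integrates its estimate. The factor
  \<open>1 / fact K\<close> is not retained.\<close>

lemma taylor_bound:
  fixes \<phi> :: "nat \<Rightarrow> real \<Rightarrow> 'a::real_inner"
  assumes "\<And>k t. k < K \<Longrightarrow> t \<in> {0..T} \<Longrightarrow> (\<phi> k has_vector_derivative \<phi> (Suc k) t) (at t within {0..T})"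
    and "\<And>t. t \<in> {0..T} \<Longrightarrow> norm (\<phi> K t) \<le> B"
    and "t \<in> {0..T}"
  shows "norm (\<phi> 0 t - (\<Sum>i<K. (t ^ i / fact i) *\<^sub>R \<phi> i 0)) \<le> B * t ^ K"
  using assms
proof (induction K arbitrary: \<phi> t)
  case (Suc K)
  have B: "0 \<le> B" using Suc.prems(2,3) norm_ge_zero order_trans by blast
  define u where "u = (\<lambda>s. \<phi> 0 s - (\<Sum>i<Suc K. (s ^ i / fact i) *\<^sub>R \<phi> i 0))"
  define u' where "u' = (\<lambda>s. \<phi> 1 s - (\<Sum>i<K. (s ^ i / fact i) *\<^sub>R \<phi> (Suc i) 0))"
  have du: "(u has_vector_derivative u' s) (at s within {0..t})" if "s \<in> {0..t}" for s
  proof -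
    have "(\<phi> 0 has_vector_derivative \<phi> (Suc 0) s) (at s within {0..T})"
      using Suc.prems(1)[of 0 s] Suc.prems(3) that by auto
    then have d0: "(\<phi> 0 has_vector_derivative \<phi> (Suc 0) s) (at s within {0..t})"
      by (rule has_vector_derivative_within_subset) (use Suc.prems(3) in auto)
    have "((\<lambda>s. s ^ Suc i / fact (Suc i)) has_real_derivative s ^ i / fact i) (at s within {0..t})" for i
      using DERIV_cdivide[OF DERIV_pow[of "Suc i" s "{0..t}"], of "fact (Suc i)"]
      by (simp add: fact_Suc del: of_nat_Suc power_Suc)
    from has_vector_derivative_scaleR[OF this has_vector_derivative_const]
    have "((\<lambda>s. (s ^ Suc i / fact (Suc i)) *\<^sub>R \<phi> (Suc i) 0) has_vector_derivative
        (s ^ i / fact i) *\<^sub>R \<phi> (Suc i) 0) (at s within {0..t})" for i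
      by (simp del: power_Suc fact_Suc)
    then have "((\<lambda>s. \<Sum>i<K. (s ^ Suc i / fact (Suc i)) *\<^sub>R \<phi> (Suc i) 0) has_vector_derivative
        (\<Sum>i<K. (s ^ i / fact i) *\<^sub>R \<phi> (Suc i) 0)) (at s within {0..t})"
      by (intro has_vector_derivative_sum) auto
    from has_vector_derivative_diff[OF d0 has_vector_derivative_add[OF has_vector_derivative_const this]]
    have "((\<lambda>s. \<phi> 0 s - (\<phi> 0 0 + (\<Sum>i<K. (s ^ Suc i / fact (Suc i)) *\<^sub>R \<phi> (Suc i) 0)))
        has_vector_derivative u' s) (at s within {0..t})"
      by (simp add: u'_def del: power_Suc fact_Suc)
    moreover have "u = (\<lambda>s. \<phi> 0 s - (\<phi> 0 0 + (\<Sum>i<K. (s ^ Suc i / fact (Suc i)) *\<^sub>R \<phi> (Suc i) 0)))"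
      unfolding u_def by (subst sum.lessThan_Suc_shift) simp
    ultimately show ?thesis by simp
  qed
  have "norm (u' s) \<le> B * t ^ K" if "s \<in> {0..t}" for s
  proof -
    have "norm (u' s) \<le> B * s ^ K"
      using Suc.IH[of "\<lambda>k. \<phi> (Suc k)" s] Suc.prems that unfolding u'_def by auto
    also have "\<dots> \<le> B * t ^ K"
      using that B by (intro mult_left_mono power_mono) auto
    finally show ?thesis .
  qed
  then have "norm (u t) \<le> (norm (u 0) + B * t ^ K * t) * exp (0 * t)"
    using du B Suc.prems(3) by (intro growth_bound[where u' = u' and T = t]) auto
  moreover have "u 0 = 0"
    by (simp add: u_def sum.lessThan_Suc_shift del: sum.lessThan_Suc)
  ultimately show ?case by (simp add: u_def ac_simps)
qed simp

text \<open>\<open>lie_coeff F k j\<close> is the coefficient of \<open>h ^ j\<close> in the \<open>k\<close>-fold Lie derivative of the identity along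
  the formal field \<open>\<Sum>j. h ^ j F j\<close>, and \<open>flow_coeff F m\<close> the coefficient of \<open>h ^ m\<close> in the time-\<open>h\<close> flow of
  that field.\<close>

primrec lie_coeff :: "(nat \<Rightarrow> 'a \<Rightarrow> 'a) \<Rightarrow> nat \<Rightarrow> nat \<Rightarrow> 'a::real_normed_vector \<Rightarrow> 'a" where
  "lie_coeff F 0 = (\<lambda>j x. if j = 0 then x else 0)"
| "lie_coeff F (Suc k) =
     (\<lambda>j x. \<Sum>i\<le>j. frechet_derivative (lie_coeff F k i) (at x) (F (j - i) x))"

lemma smooth_lie_coeff:
  fixes F :: "nat \<Rightarrow> 'a::euclidean_space \<Rightarrow> 'a"
  assumes "\<And>j. smooth (F j)"
  shows "smooth (lie_coeff F k j)"
proof (induction k arbitrary: j)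
  case 0
  then show ?case by (cases "j = 0") simp_all
next
  case (Suc k)
  then show ?case by (auto intro!: smooth_sum smooth_lie_derivative assms)
qed

lemma lie_coeff_cong:
  "(\<And>i. i \<le> j \<Longrightarrow> F i = F' i) \<Longrightarrow> lie_coeff F k j = lie_coeff F' k j"
proof (induction k arbitrary: j)
  case (Suc k)
  have "lie_coeff F k i = lie_coeff F' k i" "F (j - i) = F' (j - i)" if "i \<le> j" for i
    using that Suc by auto
  then show ?case by (auto intro!: ext sum.cong)
qed simp

lemma lie_coeff_1: "lie_coeff F (Suc 0) j = F j"
proof
  fix x
  have "frechet_derivative (\<lambda>x::'a. if i = 0 then x else 0) (at x) v = (if i = 0 then v else 0)" for i :: nat and v
    by (cases "i = 0") simp_all
  then show "lie_coeff F (Suc 0) j x = F j x" by (simp add: sum.delta)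
qed

lemma derivative_zero_arg: "smooth g \<Longrightarrow> frechet_derivative g (at x) 0 = 0"
  by (intro linear_0 linear_frechet_derivative smooth_differentiable)

text \<open>Every Lie derivative contributes one factor of the field, so for a field of degree
  \<open>M\<close> in \<open>h\<close> the \<open>k\<close>-fold one has degree at most
  \<open>k * M\<close>. This makes the finite sums in \<open>flow_expansion\<close>
  complete.\<close>

lemma lie_coeff_eq_0:
  fixes F :: "nat \<Rightarrow> 'a::euclidean_space \<Rightarrow> 'a"
  assumes "\<And>j. smooth (F j)" "\<And>j. M < j \<Longrightarrow> F j = (\<lambda>_. 0)"
  shows "k * M < j \<Longrightarrow> lie_coeff F k j = (\<lambda>_. 0)"
proof (induction k arbitrary: j)
  case (Suc k)
  have "frechet_derivative (lie_coeff F k i) (at x) (F (j - i) x) = 0" if "i \<le> j" for i x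
  proof (cases "k * M < i")
    case True
    then show ?thesis by (simp add: Suc.IH)
  next
    case False
    then have "M < j - i" using Suc.prems by auto
    then show ?thesis by (simp add: assms derivative_zero_arg smooth_lie_coeff)
  qed
  then show ?case by auto
qed auto

section \<open>Coefficients of the time-h map\<close>

definition flow_coeff :: "(nat \<Rightarrow> 'a \<Rightarrow> 'a) \<Rightarrow> nat \<Rightarrow> 'a::real_normed_vector \<Rightarrow> 'a" where
  "flow_coeff F m x = (\<Sum>k\<le>m. (1 / fact k) *\<^sub>R lie_coeff F k (m - k) x)"

text \<open>The part of \<open>flow_coeff F (Suc m)\<close> of degree at least two in the field:
  \<open>k = 0\<close> contributes nothing at positive order and \<open>k = 1\<close> gives
  \<open>F m\<close> itself. As \<open>k \<ge> 2\<close>, the index \<open>Suc m - k\<close> stays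
  below \<open>m\<close>.\<close>

definition flow_coeff_rest :: "(nat \<Rightarrow> 'a \<Rightarrow> 'a) \<Rightarrow> nat \<Rightarrow> 'a::real_normed_vector \<Rightarrow> 'a" where
  "flow_coeff_rest F m x = (\<Sum>k=2..Suc m. (1 / fact k) *\<^sub>R lie_coeff F k (Suc m - k) x)"

lemma flow_coeff_0: "flow_coeff F 0 x = x"
  by (simp add: flow_coeff_def)

lemma flow_coeff_Suc: "flow_coeff F (Suc m) x = F m x + flow_coeff_rest F m x"
proof -
  have "{..Suc m} = insert 0 (insert 1 {2..Suc m})" by auto
  then have "flow_coeff F (Suc m) x = lie_coeff F 1 m x + flow_coeff_rest F m x"
    by (simp add: flow_coeff_def flow_coeff_rest_def)
  then show ?thesis by (simp add: lie_coeff_1 del: lie_coeff.simps)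
qed

lemma flow_coeff_rest_cong:
  assumes "\<And>i. i < m \<Longrightarrow> F i = F' i"
  shows "flow_coeff_rest F m = flow_coeff_rest F' m"
  unfolding flow_coeff_rest_def
  by (intro ext sum.cong arg_cong2[of _ _ _ _ scaleR] fun_cong[OF lie_coeff_cong] assms refl) auto

lemma smooth_flow_coeff_rest:
  fixes F :: "nat \<Rightarrow> 'a::euclidean_space \<Rightarrow> 'a"
  shows "(\<And>j. smooth (F j)) \<Longrightarrow> smooth (flow_coeff_rest F m)"
  unfolding flow_coeff_rest_def by (intro smooth_sum smooth_scaleR smooth_lie_coeff smooth_const)

text \<open>\<open>flow_coeff_rest F m\<close> involves only \<open>F 0, \<dots>, F (m - 1)\<close>, so \<open>flow_coeff F (Suc m) = E m\<close> can be solved for \<open>F m\<close>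
  recursively.\<close>

lemma flow_coeff_surj:
  fixes E :: "nat \<Rightarrow> 'a::euclidean_space \<Rightarrow> 'a"
  assumes "\<And>m. smooth (E m)"
  obtains F where "\<And>j. smooth (F j)" "\<And>m x. flow_coeff F (Suc m) x = E m x"
proof -
  \<comment> \<open>A course-of-values recursion: \<open>G m\<close> holds the final coefficients
    below \<open>m\<close> and the zero field elsewhere, and stage \<open>m\<close> fills in index
    \<open>m\<close>. \<open>F\<close> reads off the diagonal.\<close>
  define G where "G = rec_nat (\<lambda>_ _. 0) (\<lambda>m H. H(m := \<lambda>x. E m x - flow_coeff_rest H m x))"
  have G_0: "G 0 = (\<lambda>_ _. 0)" and G_Suc: "G (Suc m) = (G m)(m := \<lambda>x. E m x - flow_coeff_rest (G m) m x)" for m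
    by (simp_all add: G_def)
  define F where "F = (\<lambda>j. G (Suc j) j)"
  have smooth_G: "smooth (G m j)" for m j
    by (induction m arbitrary: j) (auto simp: G_0 G_Suc intro!: smooth_diff assms smooth_flow_coeff_rest)
  have "G m i = F i" if "i < m" for m i
    using that by (induction m) (auto simp: G_0 G_Suc F_def less_Suc_eq)
  then have rest: "flow_coeff_rest (G m) m = flow_coeff_rest F m" for m
    by (intro flow_coeff_rest_cong) auto
  have "F m x = E m x - flow_coeff_rest (G m) m x" for m x
    by (simp add: F_def G_Suc)
  then have "flow_coeff F (Suc m) x = E m x" for m x
    by (simp only: rest flow_coeff_Suc diff_add_cancel)
  moreover have "smooth (F j)" for j
    by (simp add: F_def smooth_G)
  ultimately show thesis by (rule that[rotated])
qed

text \<open>A Cauchy product. Since the terms vanish outside the rectangle, it may be enlarged to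
  the triangle \<open>i + j \<le> m + n\<close>, which splits into diagonals of equal power of
  \<open>h\<close>.\<close>

lemma sum_convolution:
  fixes b :: "nat \<Rightarrow> nat \<Rightarrow> 'a::real_vector" and h :: real
  assumes "\<And>i j. m < i \<Longrightarrow> b i j = 0" "\<And>i j. n < j \<Longrightarrow> b i j = 0"
  shows "(\<Sum>i\<le>m. \<Sum>j\<le>n. h ^ (i + j) *\<^sub>R b i j) = (\<Sum>r\<le>m + n. h ^ r *\<^sub>R (\<Sum>i\<le>r. b i (r - i)))"
proof -
  have "(\<Sum>i\<le>m. \<Sum>j\<le>n. h ^ (i + j) *\<^sub>R b i j) = (\<Sum>(i, j)\<in>{..m} \<times> {..n}. h ^ (i + j) *\<^sub>R b i j)"
    by (simp add: sum.cartesian_product)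
  also have "\<dots> = (\<Sum>(i, j)\<in>{(i, j). i + j \<le> m + n}. h ^ (i + j) *\<^sub>R b i j)"
  proof (rule sum.mono_neutral_left)
    show "finite {(i, j). i + j \<le> m + n}"
      by (rule finite_subset[of _ "{..m + n} \<times> {..m + n}"]) auto
    show "\<forall>z\<in>{(i, j). i + j \<le> m + n} - {..m} \<times> {..n}. (case z of (i, j) \<Rightarrow> h ^ (i + j) *\<^sub>R b i j) = 0"
    proof
      fix z assume "z \<in> {(i, j). i + j \<le> m + n} - {..m} \<times> {..n}"
      then have "m < fst z \<or> n < snd z" by auto
      then show "(case z of (i, j) \<Rightarrow> h ^ (i + j) *\<^sub>R b i j) = 0"
        using assms by (auto simp: case_prod_unfold)
    qed
  qed auto
  also have "\<dots> = (\<Sum>r\<le>m + n. \<Sum>i\<le>r. h ^ (i + (r - i)) *\<^sub>R b i (r - i))"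
    by (rule sum.triangle_reindex_eq)
  also have "\<dots> = (\<Sum>r\<le>m + n. h ^ r *\<^sub>R (\<Sum>i\<le>r. b i (r - i)))"
    by (simp add: scaleR_sum_right)
  finally show ?thesis .
qed

text \<open>Along a solution, the time derivative of \<open>P h k (y t)\<close> is
  \<open>P h (Suc k) (y t)\<close>, so Taylor's formula applies at \<open>t = h\<close>. There
  \<open>h\<close> is both the time and the parameter of the field: the term with indices
  \<open>k\<close> and \<open>j\<close> carries \<open>h ^ (k + j)\<close>, and collecting equal
  powers gives \<open>flow_coeff\<close>.\<close>

lemma flow_expansion:
  fixes F :: "nat \<Rightarrow> 'a::euclidean_space \<Rightarrow> 'a"
  assumes F: "\<And>j. smooth (F j)" and M: "\<And>j. M < j \<Longrightarrow> F j = (\<lambda>_. 0)" and B: "compact B"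
  shows "\<exists>C. \<forall>h y. 0 < h \<longrightarrow> h \<le> 1 \<longrightarrow> solves_on y (\<lambda>x. \<Sum>j\<le>M. h ^ j *\<^sub>R F j x) h \<longrightarrow>
    (\<forall>t\<in>{0..h}. y t \<in> B) \<longrightarrow>
    norm (y h - (\<Sum>m<K. h ^ m *\<^sub>R flow_coeff F m (y 0))) \<le> C * h ^ K"
proof -
  note lie_coeff.simps [simp del]
  have "\<exists>b>0. \<forall>x\<in>B. norm (lie_coeff F k j x) \<le> b" for k j
    using compact_norm_bound[OF B smooth_continuous_on[OF smooth_lie_coeff[of F k j, OF F]]] by metis
  then obtain b where b_pos: "\<And>k j. 0 < b k j" and b: "\<And>k j x. x \<in> B \<Longrightarrow> norm (lie_coeff F k j x) \<le> b k j"
    by metis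
  define P where "P = (\<lambda>h k x. \<Sum>j\<le>k * M. h ^ j *\<^sub>R lie_coeff F k j x)"
  have dP: "(P h k has_derivative (\<lambda>v. \<Sum>j\<le>k * M. h ^ j *\<^sub>R frechet_derivative (lie_coeff F k j) (at x) v)) (at x)"
    for h :: real and k x
    unfolding P_def
    by (intro has_derivative_sum has_derivative_scaleR_right smooth_has_derivative smooth_lie_coeff F)
  have P_Suc: "(\<Sum>i\<le>k * M. h ^ i *\<^sub>R frechet_derivative (lie_coeff F k i) (at x) (\<Sum>j\<le>M. h ^ j *\<^sub>R F j x))
      = P h (Suc k) x" for h :: real and k x
  proof -
    have lin: "linear (frechet_derivative (lie_coeff F k i) (at x))" for i
      by (intro linear_frechet_derivative smooth_differentiable smooth_lie_coeff F)
    have "(\<Sum>i\<le>k * M. h ^ i *\<^sub>R frechet_derivative (lie_coeff F k i) (at x) (\<Sum>j\<le>M. h ^ j *\<^sub>R F j x))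
      = (\<Sum>i\<le>k * M. \<Sum>j\<le>M. h ^ (i + j) *\<^sub>R frechet_derivative (lie_coeff F k i) (at x) (F j x))"
      by (simp add: linear_sum[OF lin] linear_cmul[OF lin] scaleR_sum_right power_add)
    also have "\<dots> = (\<Sum>r\<le>k * M + M. h ^ r *\<^sub>R (\<Sum>i\<le>r. frechet_derivative (lie_coeff F k i) (at x) (F (r - i) x)))"
      by (intro sum_convolution)
         (auto simp: lie_coeff_eq_0[OF F M] M intro!: derivative_zero_arg smooth_lie_coeff F)
    also have "\<dots> = P h (Suc k) x"
      by (simp add: P_def lie_coeff.simps(2) add.commute)
    finally show ?thesis .
  qed
  define C\<^sub>1 where "C\<^sub>1 = (\<Sum>j\<le>K * M. b K j)"
  \<comment> \<open>A rectangle containing every nonzero index pair of the Taylor sum as well as the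
    triangle \<open>i + j < K\<close>. Pairs outside the triangle contribute only
    \<open>O(h ^ K)\<close>, because \<open>h \<le> 1\<close>.\<close>
  define S where "S = {..<K} \<times> {..K * M + K}"
  define C\<^sub>2 where "C\<^sub>2 = (\<Sum>(i, j)\<in>S. b i j)"
  show ?thesis
  proof (intro exI[of _ "C\<^sub>1 + C\<^sub>2"] allI impI)
    fix h :: real and y
    assume h: "0 < h" "h \<le> 1" and y: "solves_on y (\<lambda>x. \<Sum>j\<le>M. h ^ j *\<^sub>R F j x) h"
      and yB: "\<forall>t\<in>{0..h}. y t \<in> B"
    have x: "y 0 \<in> B" using yB h by auto
    have h_pow: "h ^ j \<le> 1" for j using h by (simp add: power_le_one)
    have "((\<lambda>t. P h k (y t)) has_vector_derivative P h (Suc k) (y t)) (at t within {0..h})"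
      if "t \<in> {0..h}" for k t
    proof -
      have "(y has_vector_derivative (\<Sum>j\<le>M. h ^ j *\<^sub>R F j (y t))) (at t within {0..h})"
        using y that by (auto simp: solves_on_def)
      from vector_derivative_diff_chain_within[OF this has_derivative_at_withinI[OF dP[of h k]]]
      show ?thesis by (simp add: P_Suc o_def)
    qed
    moreover have "norm (P h K (y t)) \<le> C\<^sub>1" if "t \<in> {0..h}" for t
      unfolding P_def C\<^sub>1_def
    proof (rule sum_norm_le)
      fix j
      have "norm (h ^ j *\<^sub>R lie_coeff F K j (y t)) \<le> 1 * b K j"
        using h that yB b h_pow by (simp only: norm_scaleR) (intro mult_mono, auto)
      then show "norm (h ^ j *\<^sub>R lie_coeff F K j (y t)) \<le> b K j" by simp
    qed
    ultimately have "norm (P h 0 (y h) - (\<Sum>i<K. (h ^ i / fact i) *\<^sub>R P h i (y 0))) \<le> C\<^sub>1 * h ^ K"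
      using h by (intro taylor_bound[where \<phi> = "\<lambda>k t. P h k (y t)" and T = h]) auto
    moreover have "P h 0 (y h) = y h" by (simp add: P_def lie_coeff.simps(1))
    ultimately have taylor: "norm (y h - (\<Sum>i<K. (h ^ i / fact i) *\<^sub>R P h i (y 0))) \<le> C\<^sub>1 * h ^ K"
      by simp
    define a where "a = (\<lambda>i j. h ^ (i + j) *\<^sub>R (1 / fact i) *\<^sub>R lie_coeff F i j (y 0))"
    have "(h ^ i / fact i) *\<^sub>R P h i (y 0) = (\<Sum>j\<le>K * M + K. a i j)" if "i < K" for i
    proof -
      have "i * M \<le> K * M + K" using mult_le_mono1[of i K M] that by linarith
      then have "{..i * M} \<subseteq> {..K * M + K}" by (simp only: atMost_subset_iff)
      then have "(\<Sum>j\<le>K * M + K. a i j) = (\<Sum>j\<le>i * M. a i j)"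
        by (intro sum.mono_neutral_right) (auto simp: a_def lie_coeff_eq_0[OF F M])
      then show ?thesis
        by (simp add: P_def a_def scaleR_sum_right power_add)
    qed
    then have 1: "(\<Sum>i<K. (h ^ i / fact i) *\<^sub>R P h i (y 0)) = (\<Sum>(i, j)\<in>S. a i j)"
      by (simp add: S_def sum.cartesian_product)
    have "(\<Sum>m<K. h ^ m *\<^sub>R flow_coeff F m (y 0)) = (\<Sum>m<K. \<Sum>i\<le>m. a i (m - i))"
      by (simp add: flow_coeff_def a_def scaleR_sum_right)
    also have "\<dots> = (\<Sum>(i, j)\<in>{(i, j). i + j < K}. a i j)"
      by (rule sum.triangle_reindex[symmetric])
    finally have 2: "(\<Sum>m<K. h ^ m *\<^sub>R flow_coeff F m (y 0)) = (\<Sum>(i, j)\<in>{(i, j). i + j < K}. a i j)" .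
    have S: "finite S" "{(i, j). i + j < K} \<subseteq> S" by (auto simp: S_def)
    have "norm ((\<Sum>(i, j)\<in>S. a i j) - (\<Sum>(i, j)\<in>{(i, j). i + j < K}. a i j))
        = norm (\<Sum>(i, j)\<in>S - {(i, j). i + j < K}. a i j)"
      by (simp add: sum_diff S)
    also have "\<dots> \<le> (\<Sum>(i, j)\<in>S - {(i, j). i + j < K}. h ^ K * b i j)"
    proof (rule sum_norm_le)
      fix z assume "z \<in> S - {(i, j). i + j < K}"
      then obtain i j where z: "z = (i, j)" and "\<not> i + j < K" by auto
      then have "\<bar>h ^ (i + j)\<bar> \<le> h ^ K"
        using h by (simp add: power_decreasing)
      moreover have "norm ((1 / fact i) *\<^sub>R lie_coeff F i j (y 0)) \<le> 1 * b i j"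
        unfolding norm_scaleR using b[OF x, of i j] by (intro mult_mono) (auto simp: fact_ge_1)
      ultimately have "norm (a i j) \<le> h ^ K * b i j"
        unfolding a_def norm_scaleR[of "h ^ (i + j)"] using h by (intro mult_mono) auto
      then show "norm (case z of (i, j) \<Rightarrow> a i j) \<le> (case z of (i, j) \<Rightarrow> h ^ K * b i j)"
        by (simp add: z)
    qed
    also have "\<dots> \<le> (\<Sum>(i, j)\<in>S. h ^ K * b i j)"
      using S h b_pos by (intro sum_mono2) (auto intro!: mult_nonneg_nonneg less_imp_le)
    also have "\<dots> = C\<^sub>2 * h ^ K"
      by (simp add: C\<^sub>2_def sum_distrib_left case_prod_unfold mult.commute[of _ "h ^ K"])
    finally have "norm ((\<Sum>i<K. (h ^ i / fact i) *\<^sub>R P h i (y 0)) - (\<Sum>m<K. h ^ m *\<^sub>R flow_coeff F m (y 0)))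
        \<le> C\<^sub>2 * h ^ K"
      unfolding 1 2 .
    from norm_diff_triangle_le[OF taylor this]
    show "norm (y h - (\<Sum>m<K. h ^ m *\<^sub>R flow_coeff F m (y 0))) \<le> (C\<^sub>1 + C\<^sub>2) * h ^ K"
      by (simp only: distrib_right)
  qed
qed

text \<open>\<open>F p\<close> can enter only through \<open>k = 2\<close>: for
  \<open>k \<ge> 3\<close> the remaining index is below \<open>p\<close>, where \<open>F\<close> and
  \<open>F\<^sub>0\<close> agree. In the double Lie derivative only the splittings
  \<open>0 + p\<close> and \<open>p + 0\<close> of the index survive.\<close>

lemma flow_coeff_rest_perturbation:
  fixes F :: "nat \<Rightarrow> 'a::euclidean_space \<Rightarrow> 'a"
  assumes F: "\<And>j. smooth (F j)" and p: "0 < p" and low: "\<And>j. 0 < j \<Longrightarrow> j < p \<Longrightarrow> F j = (\<lambda>_. 0)"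
  defines "F\<^sub>0 \<equiv> \<lambda>j. if j = 0 then F 0 else (\<lambda>_. 0)"
  shows "flow_coeff_rest F (Suc p) x = flow_coeff_rest F\<^sub>0 (Suc p) x +
    (1 / 2) *\<^sub>R (frechet_derivative (F 0) (at x) (F p x) + frechet_derivative (F p) (at x) (F 0 x))"
proof -
  note lie_coeff.simps [simp del]
  have split: "flow_coeff_rest H (Suc p) x = (1 / 2) *\<^sub>R lie_coeff H 2 p x +
      (\<Sum>k=3..Suc (Suc p). (1 / fact k) *\<^sub>R lie_coeff H k (Suc (Suc p) - k) x)" for H :: "nat \<Rightarrow> 'a \<Rightarrow> 'a"
    unfolding flow_coeff_rest_def
    by (subst sum.atLeast_Suc_atMost) (auto simp: numeral_2_eq_2 numeral_3_eq_3)
  have "(\<Sum>k=3..Suc (Suc p). (1 / fact k) *\<^sub>R lie_coeff F k (Suc (Suc p) - k) x) =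
      (\<Sum>k=3..Suc (Suc p). (1 / fact k) *\<^sub>R lie_coeff F\<^sub>0 k (Suc (Suc p) - k) x)"
    by (intro sum.cong arg_cong2[of _ _ _ _ scaleR] fun_cong[OF lie_coeff_cong] refl)
       (auto simp: F\<^sub>0_def low)
  moreover have two: "lie_coeff H 2 p x = (\<Sum>i\<le>p. frechet_derivative (H i) (at x) (H (p - i) x))"
    for H :: "nat \<Rightarrow> 'a \<Rightarrow> 'a"
    by (simp add: numeral_2_eq_2 lie_coeff.simps(2)[of _ "Suc 0"] lie_coeff_1)
  have "lie_coeff F\<^sub>0 2 p x = 0"
    unfolding two using p by (intro sum.neutral) (auto simp: F\<^sub>0_def derivative_zero_arg F)
  moreover have "lie_coeff F 2 p x =
      frechet_derivative (F 0) (at x) (F p x) + frechet_derivative (F p) (at x) (F 0 x)"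
  proof -
    have "lie_coeff F 2 p x = (\<Sum>i\<in>{0, p}. frechet_derivative (F i) (at x) (F (p - i) x))"
      unfolding two using low by (intro sum.mono_neutral_right) auto
    then show ?thesis using p by simp
  qed
  ultimately show ?thesis by (simp add: split)
qed

subsection \<open>Local defect\<close>

lemma lipschitz_on_linear_growth:
  assumes "L-lipschitz_on UNIV f"
  shows "norm (f x) \<le> norm (f 0) + L * norm x"
  using lipschitz_onD[OF assms, of x 0] norm_triangle_sub[of "f x" "f 0"] by (simp add: dist_norm)

lemma exact_flow_derivative:
  "is_exact_flow f \<nu> \<Longrightarrow> ((\<lambda>s. \<nu> s x) has_vector_derivative f (\<nu> t x)) (at t within S)"
  by (auto simp: is_exact_flow_def intro: has_vector_derivative_at_within)

lemma exact_flow_0: "is_exact_flow f \<nu> \<Longrightarrow> \<nu> 0 x = x"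
  by (simp add: is_exact_flow_def)

text \<open>Supplies the compact set on which \<open>flow_expansion\<close> is applied to the exact
  flow; time \<open>1\<close> covers every step size \<open>h \<le> 1\<close>.\<close>

lemma exact_flow_bounded:
  fixes f :: "'a::euclidean_space \<Rightarrow> 'a"
  assumes L: "L-lipschitz_on UNIV f" and \<nu>: "is_exact_flow f \<nu>" and B: "bounded B"
  obtains R where "\<And>x t. x \<in> B \<Longrightarrow> t \<in> {0..1} \<Longrightarrow> norm (\<nu> t x) \<le> R"
proof -
  obtain r where r: "\<And>x. x \<in> B \<Longrightarrow> norm x \<le> r"
    using B by (auto simp: bounded_iff)
  have "norm (\<nu> t x) \<le> (r + norm (f 0)) * exp L" if "x \<in> B" "t \<in> {0..1}" for x t
  proof -
    have "norm (\<nu> t x) \<le> (norm (\<nu> 0 x) + norm (f 0) * t) * exp (L * t)"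
      using that lipschitz_on_nonneg[OF L] exact_flow_derivative[OF \<nu>] lipschitz_on_linear_growth[OF L]
      by (intro growth_bound[where u' = "\<lambda>t. f (\<nu> t x)" and T = 1]) auto
    also have "\<dots> \<le> (r + norm (f 0) * 1) * exp (L * 1)"
      using that r[OF that(1)] lipschitz_on_nonneg[OF L] order_trans[OF norm_ge_zero r[OF that(1)]]
      by (intro mult_mono add_mono mult_left_mono) (auto simp: exact_flow_0[OF \<nu>] mult_left_le)
    finally show ?thesis by simp
  qed
  then show thesis by (rule that)
qed

text \<open>Three expansions up to \<open>h ^ (M + 1)\<close> are compared: of the modified
  solution, of the exact flow, and of \<open>\<Phi>\<close> relative to the exact flow. By
  \<open>coeff\<close> their polynomial parts cancel, and the three remainders add up.\<close>

lemma smooth_local_defect: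
  fixes f :: "'a::euclidean_space \<Rightarrow> 'a" and F :: "nat \<Rightarrow> 'a \<Rightarrow> 'a"
  assumes L: "L-lipschitz_on UNIV f" and \<nu>: "is_exact_flow f \<nu>" and f: "smooth f"
    and F: "\<And>j. smooth (F j)"
    and coeff: "\<And>m x. flow_coeff F (Suc m) x =
      flow_coeff (\<lambda>j. if j = 0 then f else (\<lambda>_. 0)) (Suc m) x + (if p < Suc m then d (Suc m) x else 0)"
    and \<Phi>: "has_smooth_error_expansion \<Phi> \<nu> p d"
    and B: "compact B"
  shows "\<exists>C. \<forall>\<^sub>F h in at_right 0. \<forall>y. solves_on y (\<lambda>x. \<Sum>j\<le>M. h ^ j *\<^sub>R F j x) h \<longrightarrow>
    (\<forall>t\<in>{0..h}. y t \<in> B) \<longrightarrow> norm (\<Phi> h (y 0) - y h) \<le> C * h ^ (M + 2)"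
proof -
  define F\<^sub>0 where "F\<^sub>0 = (\<lambda>j. if j = (0::nat) then f else (\<lambda>_. 0))"
  define F\<^sub>M where "F\<^sub>M = (\<lambda>j. if j \<le> M then F j else (\<lambda>_. 0))"
  have smooth_F\<^sub>M: "smooth (F\<^sub>M j)" and F\<^sub>M_0: "M < j \<Longrightarrow> F\<^sub>M j = (\<lambda>_. 0)"
    and smooth_F\<^sub>0: "smooth (F\<^sub>0 j)" and F\<^sub>0_0: "0 < j \<Longrightarrow> F\<^sub>0 j = (\<lambda>_. 0)" for j
    by (simp_all add: F\<^sub>M_def F\<^sub>0_def F f)
  obtain R where R: "\<And>x t. x \<in> B \<Longrightarrow> t \<in> {0..1} \<Longrightarrow> norm (\<nu> t x) \<le> R"
    using exact_flow_bounded[OF L \<nu> compact_imp_bounded[OF B]] by blast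
  obtain C\<^sub>1 where C\<^sub>1: "\<And>h y. 0 < h \<Longrightarrow> h \<le> 1 \<Longrightarrow> solves_on y (\<lambda>x. \<Sum>j\<le>M. h ^ j *\<^sub>R F\<^sub>M j x) h \<Longrightarrow>
      \<forall>t\<in>{0..h}. y t \<in> B \<Longrightarrow> norm (y h - (\<Sum>m<M + 2. h ^ m *\<^sub>R flow_coeff F\<^sub>M m (y 0))) \<le> C\<^sub>1 * h ^ (M + 2)"
    using flow_expansion[of F\<^sub>M M B "M + 2", OF smooth_F\<^sub>M F\<^sub>M_0 B] by blast
  obtain C\<^sub>2 where C\<^sub>2: "\<And>h y. 0 < h \<Longrightarrow> h \<le> 1 \<Longrightarrow> solves_on y (\<lambda>x. \<Sum>j\<le>0. h ^ j *\<^sub>R F\<^sub>0 j x) h \<Longrightarrow>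
      \<forall>t\<in>{0..h}. y t \<in> cball 0 R \<Longrightarrow>
      norm (y h - (\<Sum>m<M + 2. h ^ m *\<^sub>R flow_coeff F\<^sub>0 m (y 0))) \<le> C\<^sub>2 * h ^ (M + 2)"
    using flow_expansion[of F\<^sub>0 0 "cball 0 R" "M + 2", OF smooth_F\<^sub>0 F\<^sub>0_0 compact_cball] by blast
  have "loc_unif_bigo (\<lambda>h x. \<Phi> h x - (\<nu> h x + (\<Sum>j = p + 1..M + 1. h ^ j *\<^sub>R d j x))) (M + 1 + 1)"
    using \<Phi> unfolding has_smooth_error_expansion_def by blast
  then obtain C\<^sub>3 where C\<^sub>3: "\<forall>\<^sub>F h in at_right 0. \<forall>x\<in>B.
      norm (\<Phi> h x - (\<nu> h x + (\<Sum>j = p + 1..M + 1. h ^ j *\<^sub>R d j x))) \<le> C\<^sub>3 * h ^ (M + 2)"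
    using B unfolding loc_unif_bigo_def by (auto simp: add.assoc)
  \<comment> \<open>The coefficient of index \<open>m\<close> in the time-\<open>h\<close> map
    involves only \<open>F 0\<close> to \<open>F (m - 1)\<close>. Truncation at \<open>M\<close>
    therefore leaves all \<open>m < M + 2\<close> intact, which is the origin of the exponent
    \<open>M + 2\<close>.\<close>
  have "flow_coeff F\<^sub>M m x = flow_coeff F\<^sub>0 m x + (if p < m then d m x else 0)" if "m < M + 2" for m x
  proof (cases m)
    case (Suc k)
    have "flow_coeff_rest F\<^sub>M k = flow_coeff_rest F k"
      using that Suc by (intro flow_coeff_rest_cong) (auto simp: F\<^sub>M_def)
    then have "flow_coeff F\<^sub>M m x = flow_coeff F m x"
      using that Suc by (simp add: flow_coeff_Suc F\<^sub>M_def)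
    then show ?thesis using coeff[of k x] by (simp add: Suc F\<^sub>0_def)
  qed (simp add: flow_coeff_0)
  then have "(\<Sum>m<M + 2. h ^ m *\<^sub>R flow_coeff F\<^sub>M m x) =
      (\<Sum>m<M + 2. h ^ m *\<^sub>R flow_coeff F\<^sub>0 m x) + (\<Sum>m<M + 2. h ^ m *\<^sub>R (if p < m then d m x else 0))"
    for h :: real and x
    by (simp add: scaleR_add_right sum.distrib del: add_2_eq_Suc')
  moreover have "(\<Sum>m<M + 2. h ^ m *\<^sub>R (if p < m then d m x else 0)) = (\<Sum>j = p + 1..M + 1. h ^ j *\<^sub>R d j x)"
    for h :: real and x
    by (rule sum.mono_neutral_cong_right) auto
  ultimately have sums: "(\<Sum>m<M + 2. h ^ m *\<^sub>R flow_coeff F\<^sub>M m x) =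
      (\<Sum>m<M + 2. h ^ m *\<^sub>R flow_coeff F\<^sub>0 m x) + (\<Sum>j = p + 1..M + 1. h ^ j *\<^sub>R d j x)"
    for h :: real and x
    by simp
  show ?thesis
  proof (rule exI[of _ "C\<^sub>1 + C\<^sub>2 + C\<^sub>3"])
    have "\<forall>\<^sub>F h in at_right 0. 0 < h \<and> h \<le> (1::real)"
      using eventually_at_right_real[of 0 "1::real"] by (auto elim: eventually_mono)
    with C\<^sub>3 show "\<forall>\<^sub>F h in at_right 0. \<forall>y. solves_on y (\<lambda>x. \<Sum>j\<le>M. h ^ j *\<^sub>R F j x) h \<longrightarrow>
      (\<forall>t\<in>{0..h}. y t \<in> B) \<longrightarrow> norm (\<Phi> h (y 0) - y h) \<le> (C\<^sub>1 + C\<^sub>2 + C\<^sub>3) * h ^ (M + 2)"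
    proof eventually_elim
      case (elim h)
      then have h: "0 < h" "h \<le> 1" by auto
      show ?case
      proof (intro allI impI)
        fix y
        assume y: "solves_on y (\<lambda>x. \<Sum>j\<le>M. h ^ j *\<^sub>R F j x) h" and yB: "\<forall>t\<in>{0..h}. y t \<in> B"
        have x: "y 0 \<in> B" using yB h by auto
        have 1: "norm (y h - (\<Sum>m<M + 2. h ^ m *\<^sub>R flow_coeff F\<^sub>M m (y 0))) \<le> C\<^sub>1 * h ^ (M + 2)"
          using h y yB by (intro C\<^sub>1) (auto simp: F\<^sub>M_def)
        have 2: "norm (\<nu> h (y 0) - (\<Sum>m<M + 2. h ^ m *\<^sub>R flow_coeff F\<^sub>0 m (y 0))) \<le> C\<^sub>2 * h ^ (M + 2)"
          using C\<^sub>2[of h "\<lambda>t. \<nu> t (y 0)"] h R[OF x] exact_flow_derivative[OF \<nu>]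
          by (auto simp: F\<^sub>0_def solves_on_def exact_flow_0[OF \<nu>])
        have 3: "norm (\<Phi> h (y 0) - (\<nu> h (y 0) + (\<Sum>j = p + 1..M + 1. h ^ j *\<^sub>R d j (y 0)))) \<le> C\<^sub>3 * h ^ (M + 2)"
          using elim x by blast
        have shifted: "norm (\<nu> h (y 0) + (\<Sum>j = p + 1..M + 1. h ^ j *\<^sub>R d j (y 0)) -
            (\<Sum>m<M + 2. h ^ m *\<^sub>R flow_coeff F\<^sub>M m (y 0))) \<le> C\<^sub>2 * h ^ (M + 2)"
          using 2 unfolding sums by (simp only: add_diff_cancel_right)
        from norm_diff_triangle_le[OF norm_diff_triangle_le[OF 3 shifted] 1[unfolded norm_minus_commute[of "y h"]]]
        show "norm (\<Phi> h (y 0) - y h) \<le> (C\<^sub>1 + C\<^sub>2 + C\<^sub>3) * h ^ (M + 2)"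
          by (simp only: distrib_right ac_simps)
      qed
    qed
  qed
qed

text \<open>Without derivatives of the field, repeated Gronwall estimates replace the expansion.
  First come \<open>y t - \<nu> t x = O(h ^ (p + 1))\<close> and \<open>y t - x = O(h)\<close>; with
  these, \<open>y - \<nu>\<close> minus its expected drift \<open>(h ^ p * t) *\<^sub>R g x\<close>
  has a derivative of order \<open>h ^ (p + 1)\<close>. Only \<open>f\<close> is evaluated along
  \<open>\<nu>\<close>, which may leave \<open>B\<close>, whereas \<open>g\<close> is Lipschitz on
  \<open>B\<close> only.\<close>

lemma lipschitz_local_defect:
  fixes f g :: "'a::euclidean_space \<Rightarrow> 'a" and F :: "nat \<Rightarrow> 'a \<Rightarrow> 'a"
  assumes L: "L-lipschitz_on UNIV f" and \<nu>: "is_exact_flow f \<nu>" and p: "0 < p"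
    and F: "F 0 = f" "\<And>j. 0 < j \<Longrightarrow> j < p \<Longrightarrow> F j = (\<lambda>_. 0)" "F p = g"
    and g: "l-lipschitz_on B g" and B: "compact B"
    and \<Phi>: "loc_unif_bigo (\<lambda>h x. \<Phi> h x - (\<nu> h x + h ^ (p + 1) *\<^sub>R g x)) (p + 2)"
  shows "\<exists>C. \<forall>\<^sub>F h in at_right 0. \<forall>y. solves_on y (\<lambda>x. \<Sum>j\<le>p. h ^ j *\<^sub>R F j x) h \<longrightarrow>
    (\<forall>t\<in>{0..h}. y t \<in> B) \<longrightarrow> norm (\<Phi> h (y 0) - y h) \<le> C * h ^ (p + 2)"
proof -
  have L0: "0 \<le> L" and l0: "0 \<le> l" using L g by (auto intro: lipschitz_on_nonneg)
  obtain a where a: "0 < a" "\<And>x. x \<in> B \<Longrightarrow> norm (f x) \<le> a"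
    using compact_norm_bound[OF B] L lipschitz_on_continuous_on lipschitz_on_subset by (metis subset_UNIV)
  obtain b where b: "0 < b" "\<And>x. x \<in> B \<Longrightarrow> norm (g x) \<le> b"
    using compact_norm_bound[OF B lipschitz_on_continuous_on[OF g]] by blast
  obtain C where C: "\<forall>\<^sub>F h in at_right 0. \<forall>x\<in>B.
      norm (\<Phi> h x - (\<nu> h x + h ^ (p + 1) *\<^sub>R g x)) \<le> C * h ^ (p + 2)"
    using \<Phi> B unfolding loc_unif_bigo_def by blast
  have field: "(\<Sum>j\<le>p. h ^ j *\<^sub>R F j x) = f x + h ^ p *\<^sub>R g x" for h :: real and x
  proof -
    have "(\<Sum>j\<le>p. h ^ j *\<^sub>R F j x) = (\<Sum>j\<in>{0, p}. h ^ j *\<^sub>R F j x)"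
      using F(2) by (intro sum.mono_neutral_right) auto
    then show ?thesis using p F by simp
  qed
  define c where "c = L * (b * exp L) + l * (a + b)"
  show ?thesis
  proof (rule exI[of _ "C + c"])
    have "\<forall>\<^sub>F h in at_right 0. 0 < h \<and> h \<le> (1::real)"
      using eventually_at_right_real[of 0 "1::real"] by (auto elim: eventually_mono)
    with C show "\<forall>\<^sub>F h in at_right 0. \<forall>y. solves_on y (\<lambda>x. \<Sum>j\<le>p. h ^ j *\<^sub>R F j x) h \<longrightarrow>
      (\<forall>t\<in>{0..h}. y t \<in> B) \<longrightarrow> norm (\<Phi> h (y 0) - y h) \<le> (C + c) * h ^ (p + 2)"
    proof eventually_elim
      case (elim h)
      then have h: "0 < h" "h \<le> 1" by auto
      show ?case
      proof (intro allI impI)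
        fix y assume y: "solves_on y (\<lambda>x. \<Sum>j\<le>p. h ^ j *\<^sub>R F j x) h" and yB: "\<forall>t\<in>{0..h}. y t \<in> B"
        define x where "x = y 0"
        have x: "x \<in> B" using yB h by (auto simp: x_def)
        have dy: "(y has_vector_derivative f (y t) + h ^ p *\<^sub>R g (y t)) (at t within {0..h})"
          if "t \<in> {0..h}" for t
          using y that by (auto simp: solves_on_def field)
        have g_le: "norm (h ^ p *\<^sub>R g (y t)) \<le> h ^ p * b" if "t \<in> {0..h}" for t
          using h that yB b(2) by (auto intro: mult_left_mono)
        have f_le: "norm (f (y t) - f (\<nu> t x)) \<le> L * norm (y t - \<nu> t x)" for t
          using lipschitz_onD[OF L, of "y t" "\<nu> t x"] by (simp add: dist_norm)
        have 1: "norm (y t - \<nu> t x) \<le> b * exp L * h ^ (p + 1)" if t: "t \<in> {0..h}" for t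
        proof -
          have "norm (y t - \<nu> t x) \<le> (norm (y 0 - \<nu> 0 x) + h ^ p * b * t) * exp (L * t)"
          proof (rule growth_bound[where u = "\<lambda>t. y t - \<nu> t x" and T = h])
            fix t assume t: "t \<in> {0..h}"
            show "((\<lambda>t. y t - \<nu> t x) has_vector_derivative
                (f (y t) - f (\<nu> t x)) + h ^ p *\<^sub>R g (y t)) (at t within {0..h})"
              using has_vector_derivative_diff[OF dy[OF t] exact_flow_derivative[OF \<nu>]]
              by (simp add: algebra_simps)
            show "norm ((f (y t) - f (\<nu> t x)) + h ^ p *\<^sub>R g (y t)) \<le> h ^ p * b + L * norm (y t - \<nu> t x)"
              using f_le[of t] g_le[OF t] by (intro norm_triangle_le) simp
          qed (use h b L0 t in auto)
          also have "\<dots> \<le> (h ^ p * b * h) * exp (L * 1)"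
            using t h b L0 by (intro mult_mono) (auto simp: x_def exact_flow_0[OF \<nu>] mult_left_le)
          finally show ?thesis by (simp add: ac_simps)
        qed
        have 2: "norm (y t - x) \<le> (a + b) * h" if t: "t \<in> {0..h}" for t
        proof -
          have "norm (y t - x) \<le> (norm (y 0 - x) + (a + b) * t) * exp (0 * t)"
          proof (rule growth_bound[where u = "\<lambda>t. y t - x" and T = h])
            fix t assume t: "t \<in> {0..h}"
            show "((\<lambda>t. y t - x) has_vector_derivative f (y t) + h ^ p *\<^sub>R g (y t)) (at t within {0..h})"
              using has_vector_derivative_diff[OF dy[OF t] has_vector_derivative_const] by simp
            have "h ^ p * b \<le> b" using h b by (simp add: power_le_one mult_left_le_one_le)
            then show "norm (f (y t) + h ^ p *\<^sub>R g (y t)) \<le> a + b + 0 * norm (y t - x)"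
              using a(2)[of "y t"] g_le[OF t] yB t norm_triangle_ineq[of "f (y t)" "h ^ p *\<^sub>R g (y t)"] by auto
          qed (use a b t in auto)
          also have "\<dots> = (a + b) * t" by (simp add: x_def)
          also have "\<dots> \<le> (a + b) * h" using a b t by (intro mult_left_mono) auto
          finally show ?thesis .
        qed
        define w where "w = (\<lambda>t. y t - \<nu> t x - (h ^ p * t) *\<^sub>R g x)"
        have "norm (w h) \<le> (norm (w 0) + c * h ^ (p + 1) * h) * exp (0 * h)"
        proof (rule growth_bound[where T = h])
          fix t assume t: "t \<in> {0..h}"
          have "((\<lambda>t. h ^ p * t) has_real_derivative h ^ p) (at t within {0..h})"
            by (auto intro!: derivative_eq_intros)
          from has_vector_derivative_diff[OF has_vector_derivative_diff[OF dy[OF t] exact_flow_derivative[OF \<nu>]]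
              has_vector_derivative_scaleR[OF this has_vector_derivative_const]]
          show "(w has_vector_derivative (f (y t) - f (\<nu> t x)) + h ^ p *\<^sub>R (g (y t) - g x)) (at t within {0..h})"
            unfolding w_def by (simp add: algebra_simps)
          have "norm (f (y t) - f (\<nu> t x)) \<le> L * (b * exp L * h ^ (p + 1))"
            using f_le[of t] mult_left_mono[OF 1[OF t] L0] by linarith
          moreover have "norm (h ^ p *\<^sub>R (g (y t) - g x)) \<le> h ^ p * (l * ((a + b) * h))"
          proof -
            have "norm (g (y t) - g x) \<le> l * norm (y t - x)"
              using lipschitz_onD[OF g, of "y t" x] yB t x by (simp add: dist_norm)
            also have "\<dots> \<le> l * ((a + b) * h)" using 2[OF t] l0 by (intro mult_left_mono)
            finally show ?thesis using h by (simp add: mult_left_mono)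
          qed
          ultimately have "norm ((f (y t) - f (\<nu> t x)) + h ^ p *\<^sub>R (g (y t) - g x))
              \<le> L * (b * exp L * h ^ (p + 1)) + h ^ p * (l * ((a + b) * h))"
            by (intro norm_triangle_le add_mono)
          then show "norm ((f (y t) - f (\<nu> t x)) + h ^ p *\<^sub>R (g (y t) - g x)) \<le> c * h ^ (p + 1) + 0 * norm (w t)"
            by (simp add: c_def algebra_simps)
        qed (use h a b l0 L0 in \<open>auto simp: c_def\<close>)
        then have 3: "norm (w h) \<le> c * h ^ (p + 2)"
          by (simp add: w_def x_def exact_flow_0[OF \<nu>] ac_simps)
        have 4: "norm (\<Phi> h x - (\<nu> h x + h ^ (p + 1) *\<^sub>R g x)) \<le> C * h ^ (p + 2)"
          using elim(1) x by blast
        have "\<Phi> h x - y h = (\<Phi> h x - (\<nu> h x + h ^ (p + 1) *\<^sub>R g x)) - w h"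
          by (simp add: w_def mult.commute)
        also have "norm \<dots> \<le> C * h ^ (p + 2) + c * h ^ (p + 2)"
          by (rule order_trans[OF norm_triangle_ineq4 add_mono[OF 4 3]])
        finally show "norm (\<Phi> h (y 0) - y h) \<le> (C + c) * h ^ (p + 2)"
          by (simp add: x_def distrib_right)
      qed
    qed
  qed
qed

section \<open>Error expansions of the integrator\<close>

lemma leading_error_unique:
  assumes "has_leading_error \<eta> \<nu> p \<delta>" "has_smooth_error_expansion \<eta> \<nu> p d"
  shows "\<delta> = d (p + 1)"
proof
  fix x
  obtain C\<^sub>1 where C\<^sub>1: "\<forall>\<^sub>F h in at_right 0. norm (\<eta> h x - (\<nu> h x + h ^ (p + 1) *\<^sub>R \<delta> x)) \<le> C\<^sub>1 * h ^ (p + 2)"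
    using assms(1) unfolding has_leading_error_def loc_unif_bigo_def
    by (auto dest!: spec[of _ "{x}"])
  have "loc_unif_bigo (\<lambda>h x. \<eta> h x - (\<nu> h x + (\<Sum>j = p + 1..p + 1. h ^ j *\<^sub>R d j x))) (p + 1 + 1)"
    using assms(2) unfolding has_smooth_error_expansion_def by blast
  then have "loc_unif_bigo (\<lambda>h x. \<eta> h x - (\<nu> h x + h ^ (p + 1) *\<^sub>R d (p + 1) x)) (p + 2)"
    by (simp add: numeral_2_eq_2)
  then obtain C\<^sub>2 where C\<^sub>2: "\<forall>\<^sub>F h in at_right 0. norm (\<eta> h x - (\<nu> h x + h ^ (p + 1) *\<^sub>R d (p + 1) x)) \<le> C\<^sub>2 * h ^ (p + 2)"
    unfolding loc_unif_bigo_def by (auto dest!: spec[of _ "{x}"])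
  \<comment> \<open>Both expansions approximate the same \<open>\<eta> h x\<close>, so
    \<open>h ^ (p + 1)\<close> times the difference of the coefficients is
    \<open>O(h ^ (p + 2))\<close>. Division leaves a fixed vector bounded by a multiple of
    \<open>h\<close>.\<close>
  have "\<forall>\<^sub>F h in at_right 0. norm (\<delta> x - d (p + 1) x) \<le> (C\<^sub>1 + C\<^sub>2) * h"
    using C\<^sub>1 C\<^sub>2 eventually_at_right_less[of 0]
  proof eventually_elim
    case (elim h)
    have "h ^ (p + 1) * norm (\<delta> x - d (p + 1) x) = norm (h ^ (p + 1) *\<^sub>R \<delta> x - h ^ (p + 1) *\<^sub>R d (p + 1) x)"
      using elim by (simp flip: scaleR_diff_right)
    also have "\<dots> = norm ((\<eta> h x - (\<nu> h x + h ^ (p + 1) *\<^sub>R d (p + 1) x)) - (\<eta> h x - (\<nu> h x + h ^ (p + 1) *\<^sub>R \<delta> x)))"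
      by simp
    also have "\<dots> \<le> C\<^sub>2 * h ^ (p + 2) + C\<^sub>1 * h ^ (p + 2)"
      by (rule order_trans[OF norm_triangle_ineq4 add_mono[OF elim(2,1)]])
    also have "\<dots> = h ^ (p + 1) * ((C\<^sub>1 + C\<^sub>2) * h)"
      by (simp add: algebra_simps)
    finally show ?case
      using elim by (simp only: mult_le_cancel_left_pos zero_less_power)
  qed
  moreover have "((\<lambda>h. (C\<^sub>1 + C\<^sub>2) * h) \<longlongrightarrow> 0) (at_right 0)"
    by (auto intro!: tendsto_eq_intros)
  ultimately have "norm (\<delta> x - d (p + 1) x) \<le> 0"
    by (intro tendsto_lowerbound[where F = "at_right (0::real)"]) auto
  then show "\<delta> x = d (p + 1) x" by simp
qed

lemma enhanced_flow_smooth_error_expansion: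
  assumes \<eta>: "has_smooth_error_expansion \<eta> \<nu> p d" and N: "smooth N"
  shows "has_smooth_error_expansion (enhanced_flow \<eta> p N) \<nu> p (d(p + 1 := \<lambda>x. d (p + 1) x + N x))"
    (is "has_smooth_error_expansion _ _ _ ?d")
  unfolding has_smooth_error_expansion_def
proof (intro conjI allI impI)
  show "smooth (?d j)" if "p < j" for j
    using \<eta> N that by (auto simp: has_smooth_error_expansion_def intro: smooth_add)
  fix M
  have \<eta>_M: "loc_unif_bigo (\<lambda>h x. \<eta> h x - (\<nu> h x + (\<Sum>j=p+1..M. h ^ j *\<^sub>R d j x))) (M + 1)"
    using \<eta> by (simp add: has_smooth_error_expansion_def)
  show "loc_unif_bigo (\<lambda>h x. enhanced_flow \<eta> p N h x - (\<nu> h x + (\<Sum>j=p+1..M. h ^ j *\<^sub>R ?d j x))) (M + 1)"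
  proof (cases "p + 1 \<le> M")
    case True
    then have "{p+1..M} = insert (p + 1) {p+2..M}" by auto
    then have eq: "enhanced_flow \<eta> p N h x - (\<nu> h x + (\<Sum>j=p+1..M. h ^ j *\<^sub>R ?d j x)) =
        \<eta> h x - (\<nu> h x + (\<Sum>j=p+1..M. h ^ j *\<^sub>R d j x))" for h x
      by (simp add: enhanced_flow_def scaleR_add_right)
    show ?thesis unfolding eq by (rule \<eta>_M)
  next
    \<comment> \<open>Too short an expansion to see the network term: the sum is empty and
      \<open>h ^ (p + 1) *\<^sub>R N x\<close> itself must be absorbed into the remainder, which
      \<open>M \<le> p\<close> and \<open>h \<le> 1\<close> permit.\<close>
    case False
    show ?thesis
      unfolding loc_unif_bigo_def
    proof (intro allI impI)
      fix K :: "'a set" assume K: "compact K"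
      obtain C where C: "\<forall>\<^sub>F h in at_right 0. \<forall>x\<in>K. norm (\<eta> h x - \<nu> h x) \<le> C * h ^ (M + 1)"
        using \<eta>_M K False unfolding loc_unif_bigo_def by auto
      obtain b where b: "0 < b" "\<And>x. x \<in> K \<Longrightarrow> norm (N x) \<le> b"
        using compact_norm_bound[OF K smooth_continuous_on[OF N]] by blast
      have "\<forall>\<^sub>F h in at_right 0. 0 < h \<and> h \<le> (1::real)"
        using eventually_at_right_real[of 0 "1::real"] by (auto elim: eventually_mono)
      with C have "\<forall>\<^sub>F h in at_right 0. \<forall>x\<in>K.
          norm (enhanced_flow \<eta> p N h x - (\<nu> h x + (\<Sum>j=p+1..M. h ^ j *\<^sub>R ?d j x))) \<le> (C + b) * h ^ (M + 1)"
      proof eventually_elim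
        case (elim h)
        show ?case
        proof
          fix x assume x: "x \<in> K"
          have "h ^ (p + 1) * norm (N x) \<le> h ^ (M + 1) * b"
            using elim False b x by (intro mult_mono power_decreasing) auto
          then have "norm (h ^ (p + 1) *\<^sub>R N x) \<le> b * h ^ (M + 1)"
            using elim by (simp add: mult.commute)
          then have "norm ((\<eta> h x - \<nu> h x) + h ^ (p + 1) *\<^sub>R N x) \<le> C * h ^ (M + 1) + b * h ^ (M + 1)"
            using elim x by (intro norm_triangle_le add_mono) auto
          then show "norm (enhanced_flow \<eta> p N h x - (\<nu> h x + (\<Sum>j=p+1..M. h ^ j *\<^sub>R ?d j x))) \<le> (C + b) * h ^ (M + 1)"
            using False by (simp add: enhanced_flow_def algebra_simps)
        qed
      qed
      then show "\<exists>C. \<forall>\<^sub>F h in at_right 0. \<forall>x\<in>K.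
          norm (enhanced_flow \<eta> p N h x - (\<nu> h x + (\<Sum>j=p+1..M. h ^ j *\<^sub>R ?d j x))) \<le> C * h ^ (M + 1)"
        by blast
    qed
  qed
qed

subsection \<open>From local to global error\<close>

lemma solution_distance:
  fixes G :: "'a::euclidean_space \<Rightarrow> 'a"
  assumes G: "L-lipschitz_on UNIV G" and z: "solves_on z G T" and w: "solves_on w G T" and t: "t \<in> {0..T}"
  shows "norm (z t - w t) \<le> norm (z 0 - w 0) * exp (L * t)"
proof -
  have "norm (z t - w t) \<le> (norm (z 0 - w 0) + 0 * t) * exp (L * t)"
  proof (rule growth_bound[where u = "\<lambda>s. z s - w s" and T = T])
    show "((\<lambda>s. z s - w s) has_vector_derivative G (z s) - G (w s)) (at s within {0..T})"
      if "s \<in> {0..T}" for s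
      using z w that by (auto simp: solves_on_def intro!: has_vector_derivative_diff)
    show "norm (G (z s) - G (w s)) \<le> 0 + L * norm (z s - w s)" for s
      using lipschitz_onD[OF G, of "z s" "w s"] by (simp add: dist_norm)
  qed (use t lipschitz_on_nonneg[OF G] in auto)
  then show ?thesis by simp
qed

lemma solves_on_subinterval:
  assumes "solves_on y g T" "0 \<le> a" "a + S \<le> T"
  shows "solves_on (\<lambda>s. y (a + s)) g S"
  unfolding solves_on_def
proof
  fix s assume s: "s \<in> {0..S}"
  have "(y has_vector_derivative g (y (a + s))) (at (a + s) within {0..T})"
    using assms s by (auto simp: solves_on_def)
  then have "(y has_vector_derivative g (y (a + s))) (at (a + s) within (+) a ` {0..S})"
    by (rule has_vector_derivative_within_subset) (use assms in auto)
  moreover have "((+) a has_vector_derivative 1) (at s within {0..S})"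
    by (auto intro!: derivative_eq_intros)
  ultimately have "((y \<circ> (+) a) has_vector_derivative 1 *\<^sub>R g (y (a + s))) (at s within {0..S})"
    by (intro vector_diff_chain_within)
  then show "((\<lambda>s. y (a + s)) has_vector_derivative g (y (a + s))) (at s within {0..S})"
    by (simp add: o_def)
qed

text \<open>Outside a large ball the correction terms are frozen by projecting onto the ball. This makes the
  truncated field globally Lipschitz; its solutions never leave the ball because the growth bound
  involves only the linear growth of the leading term.\<close>

lemma modified_equation_uptoI:
  fixes F :: "nat \<Rightarrow> 'a::euclidean_space \<Rightarrow> 'a"
  assumes L: "L-lipschitz_on UNIV (F 0)"
    and Lip: "\<And>j K. 0 < j \<Longrightarrow> j \<le> M \<Longrightarrow> compact K \<Longrightarrow> \<exists>l. l-lipschitz_on K (F j)"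
    and defect: "\<And>B. compact B \<Longrightarrow> \<exists>C. \<forall>\<^sub>F h in at_right 0. \<forall>y.
      solves_on y (\<lambda>x. \<Sum>j\<le>M. h ^ j *\<^sub>R F j x) h \<longrightarrow> (\<forall>t\<in>{0..h}. y t \<in> B) \<longrightarrow>
      norm (\<Phi> h (y 0) - y h) \<le> C * h ^ (M + 2)"
  shows "modified_equation_upto M \<Phi> F"
  unfolding modified_equation_upto_def
proof (intro allI impI, elim conjE)
  fix K :: "'a set" and T :: real
  assume K: "compact K" and T: "0 < T"
  obtain r where r: "0 < r" "\<And>x. x \<in> K \<Longrightarrow> norm x \<le> r"
    using compact_imp_bounded[OF K] by (auto simp: bounded_pos)
  have L0: "0 \<le> L" by (rule lipschitz_on_nonneg[OF L])
  \<comment> \<open>The \<open>1\<close> is room for all correction terms together, whose sum is at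
    most \<open>h * b\<^sub>0\<close>. Thus \<open>R\<close> does not depend on the bounds
    \<open>b j\<close>, which are taken on \<open>cball 0 R\<close>; otherwise the choice would be
    circular.\<close>
  define A where "A = norm (F 0 0) + 1"
  \<comment> \<open>Modified solutions from \<open>K\<close> stay within
    \<open>R\<^sub>1 - 1\<close>, iterates at distance at most \<open>1\<close> from them within
    \<open>R\<^sub>1\<close>, and modified solutions restarted at such iterates within
    \<open>R\<close>.\<close>
  define R\<^sub>1 where "R\<^sub>1 = (r + A * T) * exp (L * T) + 1"
  define R where "R = (R\<^sub>1 + A * T) * exp (L * T)"
  have A: "0 < A" by (simp add: A_def add_nonneg_pos)
  have R\<^sub>1: "0 < R\<^sub>1" using r A T by (simp add: R\<^sub>1_def add_nonneg_pos)
  have R: "0 < R" using R\<^sub>1 A T by (simp add: R_def add_pos_nonneg)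
  define \<pi> where "\<pi> = closest_point (cball (0::'a) R)"
  have \<pi>_in: "\<pi> x \<in> cball 0 R" for x
    unfolding \<pi>_def using R by (intro closest_point_in_set) auto
  have \<pi>_id: "\<pi> x = x" if "norm x \<le> R" for x
    using that by (simp add: \<pi>_def closest_point_self)
  have \<pi>_lip: "dist (\<pi> x) (\<pi> y) \<le> dist x y" for x y
    unfolding \<pi>_def using R by (intro closest_point_lipschitz) auto
  have "\<exists>l. 0 < j \<longrightarrow> j \<le> M \<longrightarrow> l-lipschitz_on (cball 0 R) (F j)" for j
    using Lip[of j "cball 0 R"] by auto
  then obtain l where l: "\<And>j. 0 < j \<Longrightarrow> j \<le> M \<Longrightarrow> (l j)-lipschitz_on (cball 0 R) (F j)"
    by metis
  have l0: "0 \<le> l j" if "j \<in> {1..M}" for j using that lipschitz_on_nonneg[OF l[of j]] by auto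
  have "\<exists>b>0. 0 < j \<longrightarrow> j \<le> M \<longrightarrow> (\<forall>x\<in>cball 0 R. norm (F j x) \<le> b)" for j
  proof (cases "0 < j \<and> j \<le> M")
    case True
    then obtain B where "0 < B" "\<And>x. x \<in> cball 0 R \<Longrightarrow> norm (F j x) \<le> B"
      using compact_norm_bound[OF compact_cball lipschitz_on_continuous_on[OF l[of j]]] by blast
    then show ?thesis by (intro exI[of _ B]) simp
  qed (auto intro: exI[of _ 1])
  then obtain b where "\<forall>j. 0 < b j \<and> (0 < j \<longrightarrow> j \<le> M \<longrightarrow> (\<forall>x\<in>cball 0 R. norm (F j x) \<le> b j))"
    by metis
  then have b: "0 < b j" "0 < j \<Longrightarrow> j \<le> M \<Longrightarrow> x \<in> cball 0 R \<Longrightarrow> norm (F j x) \<le> b j" for j x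
    by blast+
  define b\<^sub>0 where "b\<^sub>0 = (\<Sum>j=1..M. b j)"
  have b\<^sub>0: "0 \<le> b\<^sub>0" unfolding b\<^sub>0_def by (intro sum_nonneg less_imp_le b(1))
  define l\<^sub>0 where "l\<^sub>0 = L + (\<Sum>j=1..M. l j)"
  have l\<^sub>0: "0 \<le> l\<^sub>0" unfolding l\<^sub>0_def using L0 l0 by (intro add_nonneg_nonneg sum_nonneg) auto
  define G where "G = (\<lambda>h x. F 0 x + (\<Sum>j=1..M. h ^ j *\<^sub>R F j (\<pi> x)))"
  obtain C\<^sub>0 where C\<^sub>0: "\<forall>\<^sub>F h in at_right 0. \<forall>y.
      solves_on y (\<lambda>x. \<Sum>j\<le>M. h ^ j *\<^sub>R F j x) h \<longrightarrow> (\<forall>t\<in>{0..h}. y t \<in> cball 0 R) \<longrightarrow>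
      norm (\<Phi> h (y 0) - y h) \<le> C\<^sub>0 * h ^ (M + 2)"
    using defect[OF compact_cball] by blast
  define C where "C = max 0 C\<^sub>0"
  define D where "D = C * exp (l\<^sub>0 * T)"
  have C: "0 \<le> C" and D: "0 \<le> D" by (auto simp: C_def D_def)
  have small: "\<forall>\<^sub>F h in at_right 0. h < a" if "0 < a" for a :: real
    using eventually_at_right_real[OF that] by (auto elim: eventually_mono)
  have small_1: "\<forall>\<^sub>F h in at_right 0. h < (1::real)"
    by (rule small) simp
  have small_b\<^sub>0: "\<forall>\<^sub>F h in at_right 0. h < 1 / (b\<^sub>0 + 1)"
    by (rule small) (use b\<^sub>0 in simp)
  \<comment> \<open>The accumulated error is at most \<open>D * T * h\<close>; below this step size
    it is at most \<open>1\<close>. The summand \<open>1\<close> in the denominator covers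
    \<open>D = 0\<close>.\<close>
  have "0 < D * T + 1" using D T by (simp add: add_nonneg_pos)
  then have small_D: "\<forall>\<^sub>F h in at_right 0. h < 1 / (D * T + 1)"
    by (intro small) simp
  have pos: "\<forall>\<^sub>F h in at_right 0. 0 < (h::real)"
    by (rule eventually_at_right_less)
  show "\<exists>C. \<forall>\<^sub>F h in at_right 0. \<forall>x\<^sub>0\<in>K. \<exists>y. y 0 = x\<^sub>0 \<and>
      solves_on y (\<lambda>x. \<Sum>j\<le>M. h ^ j *\<^sub>R F j x) T \<and>
      (\<forall>k. h * real k \<le> T \<longrightarrow> norm ((\<Phi> h ^^ k) x\<^sub>0 - y (h * real k)) \<le> C * real k * h ^ (M + 2))"
  proof (rule exI[of _ D])
    show "\<forall>\<^sub>F h in at_right 0. \<forall>x\<^sub>0\<in>K. \<exists>y. y 0 = x\<^sub>0 \<and>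
      solves_on y (\<lambda>x. \<Sum>j\<le>M. h ^ j *\<^sub>R F j x) T \<and>
      (\<forall>k. h * real k \<le> T \<longrightarrow> norm ((\<Phi> h ^^ k) x\<^sub>0 - y (h * real k)) \<le> D * real k * h ^ (M + 2))"
      using C\<^sub>0 pos small_1 small[OF T] small_b\<^sub>0 small_D
    proof eventually_elim
      case (elim h)
      have h: "0 < h" "h \<le> 1" "h \<le> T" using elim by auto
      have hb: "h * b\<^sub>0 \<le> 1" and hD: "D * T * h \<le> 1"
      proof -
        have "h * (b\<^sub>0 + 1) < 1" using elim b\<^sub>0 by (simp add: field_simps)
        then show "h * b\<^sub>0 \<le> 1" using h by (simp add: algebra_simps)
        have "h * (D * T + 1) < 1" using elim \<open>0 < D * T + 1\<close> by (simp add: field_simps)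
        then show "D * T * h \<le> 1" using h by (simp add: algebra_simps)
      qed
      have h_pow: "h ^ j \<le> h" if "0 < j" for j
        using power_decreasing[of 1 j h] h that by simp
      have G_lip: "l\<^sub>0-lipschitz_on UNIV (G h)"
      proof (rule lipschitz_onI)
        fix x y
        have "norm (G h x - G h y) = norm ((F 0 x - F 0 y) + (\<Sum>j=1..M. h ^ j *\<^sub>R (F j (\<pi> x) - F j (\<pi> y))))"
          by (simp add: G_def sum_subtractf scaleR_diff_right add_diff_add)
        also have "\<dots> \<le> L * norm (x - y) + (\<Sum>j=1..M. l j * norm (x - y))"
        proof (intro norm_triangle_le add_mono sum_norm_le)
          show "norm (F 0 x - F 0 y) \<le> L * norm (x - y)"
            using lipschitz_onD[OF L, of x y] by (simp add: dist_norm)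
          fix j assume j: "j \<in> {1..M}"
          have "norm (F j (\<pi> x) - F j (\<pi> y)) \<le> l j * dist (\<pi> x) (\<pi> y)"
            using lipschitz_onD[OF l[of j] \<pi>_in \<pi>_in] j by (simp add: dist_norm)
          also have "\<dots> \<le> l j * norm (x - y)"
            using l0[OF j] \<pi>_lip[of x y] by (simp add: mult_left_mono dist_norm)
          finally have *: "norm (F j (\<pi> x) - F j (\<pi> y)) \<le> l j * norm (x - y)" .
          have "norm (h ^ j *\<^sub>R (F j (\<pi> x) - F j (\<pi> y))) \<le> 1 * (l j * norm (x - y))"
            unfolding norm_scaleR using * h by (intro mult_mono) (auto simp: power_le_one)
          then show "norm (h ^ j *\<^sub>R (F j (\<pi> x) - F j (\<pi> y))) \<le> l j * norm (x - y)" by simp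
        qed
        finally show "dist (G h x) (G h y) \<le> l\<^sub>0 * dist x y"
          by (simp add: dist_norm l\<^sub>0_def distrib_right sum_distrib_right)
      qed (rule l\<^sub>0)
      have G_eq: "G h x = (\<Sum>j\<le>M. h ^ j *\<^sub>R F j x)" if "norm x \<le> R" for x
      proof -
        have "{..M} = insert 0 {1..M}" by auto
        then show ?thesis using that by (simp add: G_def \<pi>_id)
      qed
      have G_growth: "norm (G h x) \<le> A + L * norm x" for x
      proof -
        have "norm (\<Sum>j=1..M. h ^ j *\<^sub>R F j (\<pi> x)) \<le> (\<Sum>j=1..M. h * b j)"
        proof (rule sum_norm_le)
          fix j assume "j \<in> {1..M}"
          then show "norm (h ^ j *\<^sub>R F j (\<pi> x)) \<le> h * b j"
            unfolding norm_scaleR using h h_pow[of j] b(2)[OF _ _ \<pi>_in] by (intro mult_mono) auto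
        qed
        also have "\<dots> \<le> 1" using hb by (simp add: b\<^sub>0_def sum_distrib_left)
        finally show ?thesis
          using lipschitz_on_linear_growth[OF L, of x] norm_triangle_ineq[of "F 0 x"]
          unfolding G_def A_def by (smt (verit))
      qed
      have sol: "\<exists>y. y 0 = x \<and> solves_on y (G h) T \<and> solves_on y (\<lambda>x. \<Sum>j\<le>M. h ^ j *\<^sub>R F j x) T \<and>
          (\<forall>t\<in>{0..T}. norm (y t) \<le> (s + A * T) * exp (L * T) \<and> norm (y t) \<le> R)"
        if x: "norm x \<le> s" and s: "s \<le> R\<^sub>1" for x s
      proof -
        obtain y where y: "y 0 = x" "solves_on y (G h) T"
          using picard_lindeloef_global[OF G_lip, of T x] T by auto
        have growth: "norm (y t) \<le> (s + A * T) * exp (L * T)" if t: "t \<in> {0..T}" for t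
        proof -
          have "norm (y t) \<le> (norm (y 0) + A * t) * exp (L * t)"
            using y(2) G_growth A L0 t
            by (intro growth_bound[where u' = "\<lambda>t. G h (y t)" and T = T]) (auto simp: solves_on_def)
          also have "\<dots> \<le> (s + A * T) * exp (L * T)"
            using x t A L0 T order_trans[OF norm_ge_zero x]
            by (intro mult_mono add_mono mult_left_mono) (auto simp: y mult_left_mono intro!: add_nonneg_nonneg)
          finally show ?thesis .
        qed
        have "(s + A * T) * exp (L * T) \<le> R"
          using s by (simp add: R_def)
        with growth have le_R: "norm (y t) \<le> R" if "t \<in> {0..T}" for t
          using that by (meson order_trans)
        then have "solves_on y (\<lambda>x. \<Sum>j\<le>M. h ^ j *\<^sub>R F j x) T"
          using y(2) G_eq unfolding solves_on_def by metis
        with y growth le_R show ?thesis by blast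
      qed
      show ?case
      proof
        fix x\<^sub>0 assume "x\<^sub>0 \<in> K"
        then have x\<^sub>0: "norm x\<^sub>0 \<le> r" by (rule r)
        have "r \<le> (r + A * T) * 1" using A T by simp
        also have "\<dots> \<le> (r + A * T) * exp (L * T)"
          using A T L0 r by (intro mult_left_mono) auto
        finally have "r \<le> R\<^sub>1" by (simp add: R\<^sub>1_def)
        from sol[OF x\<^sub>0 this] obtain y where y: "y 0 = x\<^sub>0" "solves_on y (G h) T"
          "solves_on y (\<lambda>x. \<Sum>j\<le>M. h ^ j *\<^sub>R F j x) T"
          "\<And>t. t \<in> {0..T} \<Longrightarrow> norm (y t) \<le> R\<^sub>1 - 1"
          by (auto simp: R\<^sub>1_def)
        have exp_le: "C * real k * exp (l\<^sub>0 * (h * real k)) * h ^ (M + 2) \<le> D * real k * h ^ (M + 2)"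
          if "h * real k \<le> T" for k
        proof -
          have "C * real k * exp (l\<^sub>0 * (h * real k)) \<le> C * real k * exp (l\<^sub>0 * T)"
            using that C l\<^sub>0 by (intro mult_left_mono) (auto intro: mult_left_mono)
          then show ?thesis using h by (intro mult_right_mono) (auto simp: D_def ac_simps)
        qed
        \<comment> \<open>The exponent grows with the elapsed time \<open>h * real k\<close>, so
          that the amplification \<open>exp (l\<^sub>0 * h)\<close> of one step is absorbed; a claim
          with the uniform constant \<open>D\<close> would not reproduce itself in the
          induction.\<close>
        have err: "norm ((\<Phi> h ^^ k) x\<^sub>0 - y (h * real k)) \<le> C * real k * exp (l\<^sub>0 * (h * real k)) * h ^ (M + 2)"
          if "h * real k \<le> T" for k
          using that
        proof (induction k)
          case 0
          then show ?case by (simp add: y)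
        next
          case (Suc k)
          define x where "x = (\<Phi> h ^^ k) x\<^sub>0"
          define e where "e = C * real k * exp (l\<^sub>0 * (h * real k)) * h ^ (M + 2)"
          have hk: "0 \<le> h * real k" "h * real k + h \<le> T" using Suc.prems h by (auto simp: algebra_simps)
          have xe: "norm (x - y (h * real k)) \<le> e"
            using Suc.IH hk h by (simp add: x_def e_def)
          \<comment> \<open>Bootstrap: the error so far is at most \<open>1\<close>, so the iterate
            lies in the ball of radius \<open>R\<^sub>1\<close>, where a modified solution
            \<open>z\<close> can be restarted and the local defect is available.\<close>
          have "e \<le> D * real k * h ^ (M + 2)"
            using exp_le[of k] hk h by (simp add: e_def)
          also have "\<dots> = D * (h * real k) * h ^ (M + 1)" by simp
          also have "\<dots> \<le> D * T * h"
            using hk h D T h_pow[of "M + 1"] by (intro mult_mono) auto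
          also have "\<dots> \<le> 1" by (rule hD)
          finally have "norm (x - y (h * real k)) \<le> 1" using xe by simp
          moreover have "norm (y (h * real k)) \<le> R\<^sub>1 - 1" using hk h by (intro y) auto
          ultimately have "norm x \<le> R\<^sub>1"
            using norm_triangle_sub[of x "y (h * real k)"] by linarith
          from sol[OF this order_refl] obtain z where z: "z 0 = x" "solves_on z (G h) T"
            "solves_on z (\<lambda>x. \<Sum>j\<le>M. h ^ j *\<^sub>R F j x) T" "\<And>t. t \<in> {0..T} \<Longrightarrow> norm (z t) \<le> R"
            by auto
          have "norm (\<Phi> h (z 0) - z h) \<le> C\<^sub>0 * h ^ (M + 2)"
            using elim(1) solves_on_subinterval[OF z(3), of 0 h] z(4) h by auto
          also have "\<dots> \<le> C * h ^ (M + 2)" using h by (intro mult_right_mono) (auto simp: C_def)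
          finally have 1: "norm (\<Phi> h x - z h) \<le> C * h ^ (M + 2)" by (simp add: z)
          have "norm (z h - y (h * real k + h)) \<le> norm (z 0 - y (h * real k + 0)) * exp (l\<^sub>0 * h)"
            using solution_distance[OF G_lip solves_on_subinterval[OF z(2), of 0 h]
                solves_on_subinterval[OF y(2), of "h * real k" h], of h] hk h by simp
          also have "\<dots> \<le> e * exp (l\<^sub>0 * h)"
            using xe by (simp add: z)
          finally have "norm (z h - y (h * real k + h)) \<le> e * exp (l\<^sub>0 * h)" .
          from norm_diff_triangle_le[OF 1 this]
          have "norm (\<Phi> h x - y (h * real k + h)) \<le> C * h ^ (M + 2) + e * exp (l\<^sub>0 * h)" .
          also have "C * h ^ (M + 2) \<le> C * exp (l\<^sub>0 * (h * real k + h)) * h ^ (M + 2)"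
          proof (intro mult_right_mono)
            have "0 \<le> l\<^sub>0 * (h * real k + h)" using l\<^sub>0 hk h by simp
            then show "C \<le> C * exp (l\<^sub>0 * (h * real k + h))"
              using C by (simp add: mult_le_cancel_left1)
          qed (use h in auto)
          also have "e * exp (l\<^sub>0 * h) = C * real k * exp (l\<^sub>0 * (h * real k + h)) * h ^ (M + 2)"
            by (simp add: e_def distrib_left exp_add)
          also have "C * exp (l\<^sub>0 * (h * real k + h)) * h ^ (M + 2) + \<dots>
              = C * real (Suc k) * exp (l\<^sub>0 * (h * real (Suc k))) * h ^ (M + 2)"
            by (simp add: algebra_simps)
          finally show ?case by (simp add: x_def algebra_simps)
        qed
        show "\<exists>y. y 0 = x\<^sub>0 \<and> solves_on y (\<lambda>x. \<Sum>j\<le>M. h ^ j *\<^sub>R F j x) T \<and>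
            (\<forall>k. h * real k \<le> T \<longrightarrow> norm ((\<Phi> h ^^ k) x\<^sub>0 - y (h * real k)) \<le> D * real k * h ^ (M + 2))"
          using y(1,3) order_trans[OF err exp_le] by (intro exI[of _ y]) blast
      qed
    qed
  qed
qed

subsection \<open>Lipschitz continuity of neural networks\<close>

lemma lipschitz_on_sum_ex:
  fixes g :: "'i \<Rightarrow> 'a::metric_space \<Rightarrow> 'b::real_normed_vector"
  assumes "finite I" "\<And>i. i \<in> I \<Longrightarrow> \<exists>l. l-lipschitz_on S (g i)"
  shows "\<exists>l. l-lipschitz_on S (\<lambda>x. \<Sum>i\<in>I. g i x)"
  using assms
proof (induction I)
  case empty
  then show ?case using lipschitz_on_constant by auto
next
  case (insert i I)
  then obtain l\<^sub>1 l\<^sub>2 where "l\<^sub>1-lipschitz_on S (g i)" "l\<^sub>2-lipschitz_on S (\<lambda>x. \<Sum>i\<in>I. g i x)"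
    by blast
  then show ?case using insert lipschitz_on_add by fastforce
qed

lemma affine_layer_lipschitz:
  fixes \<phi> :: "'a::metric_space \<Rightarrow> real Matrix.vec"
  assumes "W \<in> carrier_mat n m" "b \<in> carrier_vec n" "\<And>x. \<phi> x \<in> carrier_vec m"
    and "\<And>i. i < m \<Longrightarrow> \<exists>l. l-lipschitz_on UNIV (\<lambda>x. vec_index (\<phi> x) i)" and i: "i < n"
  shows "\<exists>l. l-lipschitz_on UNIV (\<lambda>x. vec_index (W *\<^sub>v \<phi> x + b) i)"
proof -
  have "\<exists>l. l-lipschitz_on UNIV (\<lambda>x. W $$ (i, j) * vec_index (\<phi> x) j)" if "j < m" for j
    using assms(4)[OF that] lipschitz_on_cmult_real by blast
  then have "\<exists>l. l-lipschitz_on UNIV (\<lambda>x. \<Sum>j\<in>{0..<m}. W $$ (i, j) * vec_index (\<phi> x) j)"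
    by (intro lipschitz_on_sum_ex) auto
  then obtain l where "l-lipschitz_on UNIV (\<lambda>x. \<Sum>j\<in>{0..<m}. W $$ (i, j) * vec_index (\<phi> x) j)" ..
  then have "(l + 0)-lipschitz_on UNIV (\<lambda>x. (\<Sum>j\<in>{0..<m}. W $$ (i, j) * vec_index (\<phi> x) j) + vec_index b i)"
    by (intro lipschitz_on_add lipschitz_on_constant)
  moreover have "vec_index (W *\<^sub>v \<phi> x + b) i = (\<Sum>j\<in>{0..<m}. W $$ (i, j) * vec_index (\<phi> x) j) + vec_index b i" for x
    using assms(1,2) assms(3)[of x] i by (simp add: scalar_prod_def)
  ultimately show ?thesis by auto
qed

text \<open>\<open>nn_eval\<close> peels off the first layer, so the induction keeps the input
  general: \<open>\<phi>\<close> collects the layers already applied, and the step replaces it by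
  \<open>\<psi>\<close>, one layer further. Coordinate functions carry the Lipschitz property
  because the width varies between layers.\<close>

lemma nn_eval_lipschitz:
  fixes \<phi> :: "'a::metric_space \<Rightarrow> real Matrix.vec"
  assumes \<xi>: "L-lipschitz_on UNIV \<xi>"
  shows "nn_wf m ls n \<Longrightarrow> (\<And>x. \<phi> x \<in> carrier_vec m) \<Longrightarrow>
    (\<And>i. i < m \<Longrightarrow> \<exists>l. l-lipschitz_on UNIV (\<lambda>x. vec_index (\<phi> x) i)) \<Longrightarrow> i < n \<Longrightarrow>
    \<exists>l. l-lipschitz_on UNIV (\<lambda>x. vec_index (nn_eval \<xi> ls (\<phi> x)) i)"
proof (induction m ls n arbitrary: \<phi> i rule: nn_wf.induct)
  case (2 m W b n)
  then show ?case using affine_layer_lipschitz[of W n m b \<phi> i] by simp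
next
  case (3 m W b l ls n)
  define \<psi> where "\<psi> = (\<lambda>x. map_vec \<xi> (W *\<^sub>v \<phi> x + b))"
  have W: "W \<in> carrier_mat (dim_vec b) m" and wf: "nn_wf (dim_vec b) (l # ls) n"
    using 3 by auto
  have "\<exists>l. l-lipschitz_on UNIV (\<lambda>x. vec_index (\<psi> x) k)" if k: "k < dim_vec b" for k
  proof -
    obtain l' where "l'-lipschitz_on UNIV (\<lambda>x. vec_index (W *\<^sub>v \<phi> x + b) k)"
      using affine_layer_lipschitz[OF W carrier_vec_dim_vec 3(3,4) k] by blast
    then have "(L * l')-lipschitz_on UNIV (\<lambda>x. \<xi> (vec_index (W *\<^sub>v \<phi> x + b) k))"
      using \<xi> by (intro lipschitz_on_compose2 lipschitz_on_subset[OF \<xi>]) auto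
    moreover have "vec_index (\<psi> x) k = \<xi> (vec_index (W *\<^sub>v \<phi> x + b) k)" for x
      using k by (simp add: \<psi>_def)
    ultimately show ?thesis by auto
  qed
  then have "\<exists>l'. l'-lipschitz_on UNIV (\<lambda>x. vec_index (nn_eval \<xi> (l # ls) (\<psi> x)) i)"
    using wf 3(5) by (intro 3(1)) (auto simp: \<psi>_def intro!: carrier_vecI)
  then show ?case by (simp add: \<psi>_def)
qed simp

lemma lipschitz_on_vec_componentwise:
  fixes g :: "'a::metric_space \<Rightarrow> real ^ 'n"
  assumes "\<And>i. \<exists>l. l-lipschitz_on UNIV (\<lambda>x. g x $ i)"
  shows "\<exists>l. l-lipschitz_on UNIV g"
proof -
  obtain l where l: "\<And>i. (l i)-lipschitz_on UNIV (\<lambda>x. g x $ i)" using assms by metis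
  have "(\<Sum>i\<in>UNIV. l i)-lipschitz_on UNIV g"
  proof (rule lipschitz_onI)
    fix x y
    have "dist (g x) (g y) \<le> (\<Sum>i\<in>UNIV. \<bar>(g x - g y) $ i\<bar>)"
      unfolding dist_norm by (rule norm_le_l1_cart)
    also have "\<dots> \<le> (\<Sum>i\<in>UNIV. l i * dist x y)"
      using lipschitz_onD[OF l] by (intro sum_mono) (simp add: dist_real_def)
    finally show "dist (g x) (g y) \<le> (\<Sum>i\<in>UNIV. l i) * dist x y"
      by (simp add: sum_distrib_right)
  qed (use l lipschitz_on_nonneg in \<open>blast intro: sum_nonneg\<close>)
  then show ?thesis ..
qed

lemma neural_network_lipschitz:
  assumes "L-lipschitz_on UNIV \<xi>" "nn_wf CARD('n) \<theta> CARD('n)"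
  shows "\<exists>l. l-lipschitz_on UNIV (neural_network \<xi> \<theta> :: real ^ 'n \<Rightarrow> real ^ 'n)"
proof (rule lipschitz_on_vec_componentwise)
  fix i :: 'n
  have "to_nat_on (UNIV :: 'n set) i \<in> {..<CARD('n)}"
    using bij_betwE[OF to_nat_on_finite[OF finite_class.finite_UNIV]] by blast
  moreover have "\<exists>l. l-lipschitz_on UNIV (\<lambda>x::real ^ 'n. vec_index (to_dim_vec x) k)" if "k < CARD('n)" for k
    using that component_le_norm_cart
    by (intro exI[of _ 1] lipschitz_onI) (simp_all add: to_dim_vec_def dist_norm flip: vector_minus_component)
  ultimately show "\<exists>l. l-lipschitz_on UNIV (\<lambda>x. (neural_network \<xi> \<theta> x :: real ^ 'n) $ i)"
    unfolding neural_network_def of_dim_vec_def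
    using nn_eval_lipschitz[OF assms, of "to_dim_vec :: real ^ 'n \<Rightarrow> real Matrix.vec" "to_nat_on UNIV i"]
    by (simp add: to_dim_vec_def)
qed

subsection \<open>The modified equation\<close>

lemma modified_field_exists:
  fixes f :: "'a::euclidean_space \<Rightarrow> 'a"
  assumes L: "L-lipschitz_on UNIV f" and \<nu>: "is_exact_flow f \<nu>" and f: "smooth f" and p: "0 < p"
    and \<Phi>: "has_smooth_error_expansion \<Phi> \<nu> p d"
  obtains F where "F 0 = f" "\<And>j. 0 < j \<Longrightarrow> j < p \<Longrightarrow> F j = (\<lambda>_. 0)" "F p = d (p + 1)"
    "\<And>j. smooth (F j)"
    "F (p + 1) = (\<lambda>x. d (p + 2) x - (1 / 2) *\<^sub>R (frechet_derivative f (at x) (d (p + 1) x) +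
       frechet_derivative (d (p + 1)) (at x) (f x)))"
    "modified_equation \<Phi> F"
proof -
  define F\<^sub>0 where "F\<^sub>0 = (\<lambda>j. if j = (0::nat) then f else (\<lambda>_. 0))"
  \<comment> \<open>The coefficients that the time-\<open>h\<close> map must have: those of the
    exact flow, corrected from order \<open>p + 1\<close> on by the error terms.\<close>
  define E where "E = (\<lambda>m x. flow_coeff F\<^sub>0 (Suc m) x + (if p < Suc m then d (Suc m) x else 0))"
  have smooth_F\<^sub>0: "smooth (F\<^sub>0 j)" for j using f by (simp add: F\<^sub>0_def)
  have "smooth (E m)" for m
  proof (cases "p < Suc m")
    case True
    then have "smooth (d (Suc m))" using \<Phi> by (simp add: has_smooth_error_expansion_def)
    then show ?thesis
      using True unfolding E_def flow_coeff_Suc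
      by (auto intro!: smooth_add smooth_F\<^sub>0 smooth_flow_coeff_rest)
  next
    case False
    then show ?thesis
      unfolding E_def flow_coeff_Suc
      by (auto intro!: smooth_add smooth_F\<^sub>0 smooth_flow_coeff_rest)
  qed
  then obtain F where smooth_F: "\<And>j. smooth (F j)" and F: "\<And>m x. flow_coeff F (Suc m) x = E m x"
    using flow_coeff_surj[of E] by blast
  have F_eq: "F m x = F\<^sub>0 m x + flow_coeff_rest F\<^sub>0 m x - flow_coeff_rest F m x +
      (if p < Suc m then d (Suc m) x else 0)" for m x
    using F[of m x] by (simp add: E_def flow_coeff_Suc algebra_simps)
  \<comment> \<open>Below \<open>p\<close> the targets are those of the exact flow alone, and
    triangularity determines \<open>F\<close> from them, so \<open>F\<close> must agree with
    \<open>F\<^sub>0\<close>.\<close>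
  have F_low: "F m = F\<^sub>0 m" if "m < p" for m
    using that
  proof (induction m rule: less_induct)
    case (less m)
    then have "flow_coeff_rest F m = flow_coeff_rest F\<^sub>0 m"
      by (intro flow_coeff_rest_cong) auto
    then show ?case using F_eq[of m] less.prems by auto
  qed
  have F_0: "F 0 = f" using F_low[OF p] by (simp add: F\<^sub>0_def)
  have F_zero: "F j = (\<lambda>_. 0)" if "0 < j" "j < p" for j
    using F_low[OF that(2)] that by (simp add: F\<^sub>0_def)
  \<comment> \<open>At index \<open>p\<close> the higher Lie terms still coincide and cancel in
    \<open>F_eq\<close>, so the first error coefficient is all that is left.\<close>
  have "flow_coeff_rest F p = flow_coeff_rest F\<^sub>0 p"
    by (intro flow_coeff_rest_cong F_low)
  then have F_p: "F p = d (p + 1)"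
    using p by (auto simp: fun_eq_iff F_eq[of p] F\<^sub>0_def)
  have rest: "flow_coeff_rest F (Suc p) x = flow_coeff_rest F\<^sub>0 (Suc p) x + (1 / 2) *\<^sub>R
      (frechet_derivative f (at x) (d (p + 1) x) + frechet_derivative (d (p + 1)) (at x) (f x))" for x
  proof -
    have "flow_coeff_rest F (Suc p) x = flow_coeff_rest (\<lambda>j. if j = 0 then F 0 else (\<lambda>_. 0)) (Suc p) x +
        (1 / 2) *\<^sub>R (frechet_derivative (F 0) (at x) (F p x) + frechet_derivative (F p) (at x) (F 0 x))"
      by (intro flow_coeff_rest_perturbation smooth_F p F_zero)
    then show ?thesis unfolding F_0 F_p F\<^sub>0_def .
  qed
  have F_Suc_p: "F (p + 1) = (\<lambda>x. d (p + 2) x - (1 / 2) *\<^sub>R (frechet_derivative f (at x) (d (p + 1) x) +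
      frechet_derivative (d (p + 1)) (at x) (f x)))"
  proof
    fix x
    have "F\<^sub>0 (Suc p) x = 0" by (simp add: F\<^sub>0_def)
    with F_eq[of "Suc p" x] rest[of x] show "F (p + 1) x = d (p + 2) x - (1 / 2) *\<^sub>R
        (frechet_derivative f (at x) (d (p + 1) x) + frechet_derivative (d (p + 1)) (at x) (f x))"
      by simp
  qed
  have "modified_equation \<Phi> F"
    unfolding modified_equation_def
  proof
    fix M
    show "modified_equation_upto M \<Phi> F"
      using L F_0 smooth_lipschitz_on_compact[OF smooth_F]
        smooth_local_defect[OF L \<nu> f smooth_F _ \<Phi>] F
      by (intro modified_equation_uptoI[where L = L]) (auto simp: E_def F\<^sub>0_def)
  qed
  from F_0 F_zero F_p smooth_F F_Suc_p this show thesis by (rule that)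
qed

theorem proposition2:
  fixes f \<delta> :: "real ^ 'n \<Rightarrow> real ^ 'n"
    and \<nu> \<eta> :: "real \<Rightarrow> real ^ 'n \<Rightarrow> real ^ 'n"
    and p :: nat
    and \<xi> :: "real \<Rightarrow> real"
    and \<theta> :: nn_params
    and d :: "nat \<Rightarrow> real ^ 'n \<Rightarrow> real ^ 'n"
  defines "N \<equiv> neural_network \<xi> \<theta> :: real ^ 'n \<Rightarrow> real ^ 'n"
  assumes f_lipschitz: "\<exists>L. L-lipschitz_on UNIV f"
    and exact_flow: "is_exact_flow f \<nu>"
    and p_pos: "1 \<le> p"
    and order_p: "has_leading_error \<eta> \<nu> p \<delta>"
    and \<delta>_lipschitz: "\<And>K. compact K \<Longrightarrow> \<exists>L. L-lipschitz_on K \<delta>"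
    and \<xi>_lipschitz: "\<exists>L. L-lipschitz_on UNIV \<xi>"
    and \<theta>_wf: "nn_wf CARD('n) \<theta> CARD('n)"
  shows "\<exists>F. F 0 = f \<and> (\<forall>j. 0 < j \<and> j < p \<longrightarrow> F j = (\<lambda>_. 0)) \<and>
             F p = (\<lambda>x. \<delta> x + N x) \<and>
             modified_equation_upto p (enhanced_flow \<eta> p N) F \<and>
             (smooth f \<and> smooth N \<and> has_smooth_error_expansion \<eta> \<nu> p d \<longrightarrow>
                (\<forall>j. smooth (F j)) \<and>
                F (p + 1) = (\<lambda>x. d (p + 2) x -
                   (1 / 2) *\<^sub>R (frechet_derivative f (at x) (\<delta> x + N x) +
                              frechet_derivative (\<lambda>z. \<delta> z + N z) (at x) (f x))) \<and>
                modified_equation (enhanced_flow \<eta> p N) F)"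
proof (cases "smooth f \<and> smooth N \<and> has_smooth_error_expansion \<eta> \<nu> p d")
  \<comment> \<open>\<open>F\<close> is chosen outside the implication, so each case needs its own
    witness. Here the full series serves both claims: truncation at \<open>p\<close> is one instance
    of \<open>modified_equation\<close>, and uniqueness of the leading error ties
    \<open>\<delta>\<close> to \<open>d\<close>.\<close>
  case True
  then have f: "smooth f" and N: "smooth N" and \<eta>: "has_smooth_error_expansion \<eta> \<nu> p d"
    by auto
  obtain L where L: "L-lipschitz_on UNIV f" using f_lipschitz ..
  have \<delta>: "\<delta> = d (p + 1)" by (rule leading_error_unique[OF order_p \<eta>])
  have p: "0 < p" using p_pos by simp
  obtain F where "F 0 = f" "\<And>j. 0 < j \<Longrightarrow> j < p \<Longrightarrow> F j = (\<lambda>_. 0)" "F p = (\<lambda>x. \<delta> x + N x)" "\<And>j. smooth (F j)"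
    "F (p + 1) = (\<lambda>x. d (p + 2) x - (1 / 2) *\<^sub>R (frechet_derivative f (at x) (\<delta> x + N x) +
       frechet_derivative (\<lambda>z. \<delta> z + N z) (at x) (f x)))"
    "modified_equation (enhanced_flow \<eta> p N) F"
    using modified_field_exists[OF L exact_flow f p enhanced_flow_smooth_error_expansion[OF \<eta> N]]
    by (simp add: \<delta>) blast
  then show ?thesis
    unfolding modified_equation_def by (intro exI[of _ F]) blast
next
  case False
  obtain L where L: "L-lipschitz_on UNIV f" using f_lipschitz ..
  have p: "0 < p" using p_pos by simp
  define g where "g = (\<lambda>x. \<delta> x + N x)"
  \<comment> \<open>The implication is vacuous in this case. Up to index \<open>p\<close> the
    coefficients are prescribed by the claim; beyond it, \<open>0\<close> is a default value that
    the truncation at \<open>p\<close> never reads.\<close>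
  define F where "F = (\<lambda>j. if j = 0 then f else if j = p then g else (\<lambda>_. 0))"
  obtain l where l: "l-lipschitz_on UNIV N"
    using neural_network_lipschitz \<xi>_lipschitz \<theta>_wf unfolding N_def by blast
  have g: "\<exists>l. l-lipschitz_on K g" if "compact K" for K
    using \<delta>_lipschitz[OF that] lipschitz_on_add lipschitz_on_subset[OF l] unfolding g_def by blast
  have \<Phi>: "loc_unif_bigo (\<lambda>h x. enhanced_flow \<eta> p N h x - (\<nu> h x + h ^ (p + 1) *\<^sub>R g x)) (p + 2)"
    using order_p
    by (simp add: has_leading_error_def enhanced_flow_def g_def scaleR_add_right algebra_simps)
  have F: "F 0 = f" "\<And>j. 0 < j \<Longrightarrow> j < p \<Longrightarrow> F j = (\<lambda>_. 0)" "F p = g"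
    using p by (simp_all add: F_def)
  have "modified_equation_upto p (enhanced_flow \<eta> p N) F"
  proof (rule modified_equation_uptoI)
    show "L-lipschitz_on UNIV (F 0)" using L by (simp add: F)
    show "\<exists>l. l-lipschitz_on K (F j)" if "0 < j" "j \<le> p" "compact K" for j K
      using that g[OF that(3)] lipschitz_on_constant by (auto simp: F_def)
    show "\<exists>C. \<forall>\<^sub>F h in at_right 0. \<forall>y. solves_on y (\<lambda>x. \<Sum>j\<le>p. h ^ j *\<^sub>R F j x) h \<longrightarrow>
        (\<forall>t\<in>{0..h}. y t \<in> B) \<longrightarrow> norm (enhanced_flow \<eta> p N h (y 0) - y h) \<le> C * h ^ (p + 2)"
      if B: "compact B" for B
      using g[OF B] lipschitz_local_defect[OF L exact_flow p F _ B \<Phi>] by blast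
  qed
  then show ?thesis
    using False p by (intro exI[of _ F]) (auto simp: F_def g_def)
qed

end
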